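(* Let $f\in L^2\Lambda^n(\Omega)$ and let $\mathcal{T}_h$ be a triangulation of $\Omega$. Let $(\sigma,u,p)=\mathcal{L}^{-1}f$ and $(\tilde\sigma,\tilde u,\tilde p)=\mathcal{L}^{-1}f_{\mathfrak{B}_h}$. Then $$\|\sigma-\tilde\sigma\|\le C\,\mathrm{osc}(f,\mathcal{T}_h).$$
   Context: Let $\Omega\subset\mathbb{R}^n$ ($n\ge2$) be a bounded Lipschitz polyhedral domain. Notation for forms: - $L^2\Lambda^j(\Omega)$ is the space of square-integrable $j$-forms, with inner product $\langle\cdot,\cdot\rangle$, norm $\|\cdot\|$, and $\|\cdot\|_T$ its restriction to $T$. - $d$ is the exterior derivative, and $H\Lambda^{j}(\Omega)=\{\omega\in L^2\Lambda^j: d\omega\in L^2\Lambda^{j+1}\}$. Continuous problem (case $k=n$, no nonzero harmonic $n$-forms): for $g\in L^2\Lambda^n(\Omega)$, $\mathcal{L}^{-1}g=(\sigma,u,0)$ with $(\sigma,u)\in H\Lambda^{n-1}(\Omega)\times L^2\Lambda^n(\Omega)$ the unique solution of - $\langle\sigma,\tau\rangle-\langle d\tau,u\rangle=0$ for all $\tau\in H\Lambda^{n-1}$, - $\langle d\sigma,v\rangle=\langle g,v\rangle$ for all $v\in L^2\Lambda^n$. Discrete spaces: $\mathcal{T}_h$ is a conforming shape-regular simplicial triangulation, and $\Lambda^{n-1}_h,\Lambda^n_h$ are Arnold–Falk–Winther finite element spaces of forms on it (from $\mathcal{P}_r\Lambda$, $\mathcal{P}^-_r\Lambda$) with $d\Lambda^{n-1}_h\subset\Lambda^n_h$.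 Projections and oscillation: - $g_{\mathfrak{B}_h}$ is the $L^2$ projection of $g$ onto $\mathfrak{B}^n_h=d\Lambda^{n-1}_h$, which for $k=n$ equals the $L^2$ projection onto $\Lambda^n_h$. - $\mathrm{osc}(f,\mathcal{T}_h)=\big(\sum_{T\in\mathcal{T}_h}\|h_T(f-f_{\mathfrak{B}_h})\|_T^2\big)^{1/2}$ with $h_T=\mathrm{diam}(T)$. $C$ depends only on $\Omega$, the polynomial degree and shape regularity. *)

theory Defs
  imports "HOL-Analysis.Analysis"
begin

text \<open>Scalar proxies: n-forms on Omega are identified with real-valued functions,
 (n-1)-forms with vector fields real^'n => real^'n, and d on (n-1)-forms with the (weak)
 divergence. Integrals are Lebesgue integrals over Omega.\<close>

definition L2 :: "(real^'n) set \<Rightarrow> ((real^'n) \<Rightarrow> real) set" where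
  "L2 \<Omega> = {g. g \<in> borel_measurable (lebesgue_on \<Omega>) \<and>
                 integrable (lebesgue_on \<Omega>) (\<lambda>x. (g x)\<^sup>2)}"

definition L2vec :: "(real^'n) set \<Rightarrow> ((real^'n) \<Rightarrow> real^'n) set" where
  "L2vec \<Omega> = {s. s \<in> borel_measurable (lebesgue_on \<Omega>) \<and>
                 integrable (lebesgue_on \<Omega>) (\<lambda>x. (norm (s x))\<^sup>2)}"

definition inner_L2 :: "(real^'n) set \<Rightarrow> ((real^'n) \<Rightarrow> real) \<Rightarrow> ((real^'n) \<Rightarrow> real) \<Rightarrow> real" where
  "inner_L2 \<Omega> f g = (\<integral>x. f x * g x \<partial>lebesgue_on \<Omega>)"

definition inner_L2vec :: "(real^'n) set \<Rightarrow> ((real^'n) \<Rightarrow> real^'n) \<Rightarrow> ((real^'n) \<Rightarrow> real^'n) \<Rightarrow> real" where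
  "inner_L2vec \<Omega> s t = (\<integral>x. s x \<bullet> t x \<partial>lebesgue_on \<Omega>)"

definition norm_L2vec :: "(real^'n) set \<Rightarrow> ((real^'n) \<Rightarrow> real^'n) \<Rightarrow> real" where
  "norm_L2vec \<Omega> s = sqrt (\<integral>x. (norm (s x))\<^sup>2 \<partial>lebesgue_on \<Omega>)"

fun dirderiv :: "(real^'n) list \<Rightarrow> ((real^'n) \<Rightarrow> real) \<Rightarrow> (real^'n) \<Rightarrow> real" where
  "dirderiv [] \<phi> = \<phi>"
| "dirderiv (v # vs) \<phi> = (\<lambda>x. frechet_derivative (dirderiv vs \<phi>) (at x) v)"

definition smooth_fun :: "((real^'n) \<Rightarrow> real) \<Rightarrow> bool" where
  "smooth_fun \<phi> \<longleftrightarrow> (\<forall>vs. dirderiv vs \<phi> differentiable_on UNIV)"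

definition test_fun :: "(real^'n) set \<Rightarrow> ((real^'n) \<Rightarrow> real) \<Rightarrow> bool" where
  "test_fun \<Omega> \<phi> \<longleftrightarrow> smooth_fun \<phi> \<and> compact (closure {x. \<phi> x \<noteq> 0})
                      \<and> closure {x. \<phi> x \<noteq> 0} \<subseteq> \<Omega>"

definition weak_div :: "(real^'n) set \<Rightarrow> ((real^'n) \<Rightarrow> real^'n) \<Rightarrow> ((real^'n) \<Rightarrow> real) \<Rightarrow> bool" where
  "weak_div \<Omega> s dv \<longleftrightarrow>
     (\<forall>\<phi>. test_fun \<Omega> \<phi> \<longrightarrow>
        (\<integral>x. frechet_derivative \<phi> (at x) (s x) \<partial>lebesgue_on \<Omega>)
          = - (\<integral>x. dv x * \<phi> x \<partial>lebesgue_on \<Omega>))"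

definition Hdiv :: "(real^'n) set \<Rightarrow> ((real^'n) \<Rightarrow> real^'n) set" where
  "Hdiv \<Omega> = {s. s \<in> L2vec \<Omega> \<and> (\<exists>dv \<in> L2 \<Omega>. weak_div \<Omega> s dv)}"

text \<open>(sigma,u) is the solution of the mixed problem with data g, i.e. L^{-1} g = (sigma,u,0).\<close>
definition mixed_solution :: "(real^'n) set \<Rightarrow> ((real^'n) \<Rightarrow> real) \<Rightarrow>
     ((real^'n) \<Rightarrow> real^'n) \<Rightarrow> ((real^'n) \<Rightarrow> real) \<Rightarrow> bool" where
  "mixed_solution \<Omega> g \<sigma> u \<longleftrightarrow>
     \<sigma> \<in> Hdiv \<Omega> \<and> u \<in> L2 \<Omega> \<and>
     (\<forall>\<tau> d\<tau>. \<tau> \<in> Hdiv \<Omega> \<and> d\<tau> \<in> L2 \<Omega> \<and> weak_div \<Omega> \<tau> d\<tau> \<longrightarrow>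
        inner_L2vec \<Omega> \<sigma> \<tau> - inner_L2 \<Omega> d\<tau> u = 0) \<and>
     (\<exists>d\<sigma> \<in> L2 \<Omega>. weak_div \<Omega> \<sigma> d\<sigma> \<and>
        (\<forall>v \<in> L2 \<Omega>. inner_L2 \<Omega> d\<sigma> v = inner_L2 \<Omega> g v))"

definition is_simplex_verts :: "(real^'n) set \<Rightarrow> bool" where
  "is_simplex_verts V \<longleftrightarrow> finite V \<and> card V = CARD('n) + 1 \<and> \<not> affine_dependent V"

definition inradius :: "(real^'n) set \<Rightarrow> real" where
  "inradius T = Sup {r. \<exists>x. ball x r \<subseteq> T}"

definition conforming_triangulation :: "(real^'n) set \<Rightarrow> (real^'n) set set \<Rightarrow> bool" where
  "conforming_triangulation \<Omega> Th \<longleftrightarrow>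
     finite Th \<and> Th \<noteq> {} \<and> (\<forall>V\<in>Th. is_simplex_verts V) \<and>
     (\<Union>V\<in>Th. convex hull V) = closure \<Omega> \<and>
     (\<forall>V\<in>Th. \<forall>W\<in>Th. convex hull V \<inter> convex hull W = convex hull (V \<inter> W))"

definition shape_regular :: "real \<Rightarrow> (real^'n) set set \<Rightarrow> bool" where
  "shape_regular \<kappa> Th \<longleftrightarrow> (\<forall>V\<in>Th. diameter (convex hull V) \<le> \<kappa> * inradius (convex hull V))"

definition lipschitz_boundary :: "(real^'n) set \<Rightarrow> bool" where
  "lipschitz_boundary \<Omega> \<longleftrightarrow>
     (\<forall>x \<in> frontier \<Omega>. \<exists>r>0. \<exists>e. norm e = 1 \<and> (\<exists>L \<gamma>. L-lipschitz_on {z. z \<bullet> e = 0} \<gamma> \<and>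
        \<Omega> \<inter> ball x r = {y \<in> ball x r. (y - x) \<bullet> e < \<gamma> ((y - x) - ((y - x) \<bullet> e) *\<^sub>R e)}))"

definition polyhedral :: "(real^'n) set \<Rightarrow> bool" where
  "polyhedral \<Omega> \<longleftrightarrow> (\<exists>S. finite S \<and> (\<forall>V\<in>S. is_simplex_verts V) \<and>
                        \<Omega> = interior (\<Union>V\<in>S. convex hull V))"

definition lipschitz_polyhedral_domain :: "(real^'n) set \<Rightarrow> bool" where
  "lipschitz_polyhedral_domain \<Omega> \<longleftrightarrow> open \<Omega> \<and> connected \<Omega> \<and> \<Omega> \<noteq> {} \<and> bounded \<Omega>
      \<and> polyhedral \<Omega> \<and> lipschitz_boundary \<Omega>"

definition poly_le :: "nat \<Rightarrow> ((real^'n) \<Rightarrow> real) set" where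
  "poly_le q = {p. \<exists>c. \<forall>x. p x = (\<Sum>\<alpha>\<in>{\<alpha>::'n \<Rightarrow> nat. (\<Sum>i\<in>UNIV. \<alpha> i) \<le> q}.
                                   c \<alpha> * (\<Prod>i\<in>UNIV. (x $ i) ^ \<alpha> i))}"

text \<open>The AFW space Lambda^n_h: for P_r Lambda^n (resp. P^-_r Lambda^n) it is the space of
 discontinuous piecewise polynomials of degree <= q with q = r (resp. q = r - 1).\<close>
definition Vh :: "(real^'n) set \<Rightarrow> (real^'n) set set \<Rightarrow> nat \<Rightarrow> ((real^'n) \<Rightarrow> real) set" where
  "Vh \<Omega> Th q = {v \<in> L2 \<Omega>. \<forall>V\<in>Th. \<exists>p \<in> poly_le q.
                     AE x in lebesgue_on (interior (convex hull V)). v x = p x}"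

definition L2_proj :: "(real^'n) set \<Rightarrow> ((real^'n) \<Rightarrow> real) set \<Rightarrow> ((real^'n) \<Rightarrow> real) \<Rightarrow> ((real^'n) \<Rightarrow> real) \<Rightarrow> bool" where
  "L2_proj \<Omega> S f fP \<longleftrightarrow> fP \<in> S \<and> (\<forall>v\<in>S. inner_L2 \<Omega> (\<lambda>x. f x - fP x) v = 0)"

definition osc :: "(real^'n) set set \<Rightarrow> ((real^'n) \<Rightarrow> real) \<Rightarrow> ((real^'n) \<Rightarrow> real) \<Rightarrow> real" where
  "osc Th f fB = sqrt (\<Sum>V\<in>Th. (diameter (convex hull V))\<^sup>2 *
                     (\<integral>x. (f x - fB x)\<^sup>2 \<partial>lebesgue_on (convex hull V)))"

end

theory Submission
  imports Defs
begin

text \<open>With \<open>e = \<sigma> - \<sigma>'\<close>, \<open>w = u - u'\<close> and \<open>g = f - fB\<close>, testing the two mixed problems against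
  \<open>\<sigma>\<close> and \<open>\<sigma>'\<close> gives \<open>\<parallel>e\<parallel>\<^sup>2 = \<langle>g, w\<rangle>\<close>, a sum of contributions of the simplices, and g has mean zero on
  each of them because piecewise constants are discrete n-forms. Instead of a Poincare inequality
  for w, the dual statement is used: on a bounded convex open set U of diameter h, a mean zero
  density g is the divergence of a field \<open>\<tau>\<close> supported in U with \<open>\<parallel>\<tau>\<parallel> \<le> 2\<^bsup>n/2\<^esup> h \<parallel>g\<parallel>\<close>. The field is
  explicit: it moves the mass \<open>(g x - g y) / vol U\<close> from y to the midpoint of x and y, for all x, y
  in U. Then \<open>\<langle>g, w\<rangle>\<close> over U equals \<open>\<langle>e, \<tau>\<rangle>\<close> up to sign, and Cauchy-Schwarz concludes.\<close>

section \<open>Affine change of variables for Lebesgue measure\<close>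

lemma nn_integral_lborel_affine:
  fixes f :: "'a::euclidean_space \<Rightarrow> ennreal"
  assumes [measurable]: "f \<in> borel_measurable borel" and c: "c \<noteq> 0"
  shows "(\<integral>\<^sup>+x. f x \<partial>lborel) = ennreal (\<bar>c\<bar> ^ DIM('a)) * (\<integral>\<^sup>+x. f (a + c *\<^sub>R x) \<partial>lborel)"
  by (subst lborel_affine[OF c, of a])
     (simp add: nn_integral_density nn_integral_distr nn_integral_cmult ennreal_power)

lemma integral_lborel_affine:
  fixes f :: "'a::euclidean_space \<Rightarrow> real"
  assumes [measurable]: "f \<in> borel_measurable borel" and c: "c \<noteq> 0"
  shows "(\<integral>x. f x \<partial>lborel) = \<bar>c\<bar> ^ DIM('a) * (\<integral>x. f (a + c *\<^sub>R x) \<partial>lborel)"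
  by (subst lborel_affine[OF c, of a])
     (simp add: integral_density integral_distr ennreal_power)

section \<open>Mean zero densities on a bounded convex open set\<close>

text \<open>The density is a Borel function on the whole space that vanishes off \<open>U\<close>,
  so product measures, Fubini and affine substitution for \<open>lborel\<close> apply without
  restriction to a domain. Square integrable functions on the domain are brought into this form in
  \<open>divergence_inverse\<close>.\<close>

locale mean_zero_density =
  fixes U :: "'a::euclidean_space set" and g :: "'a \<Rightarrow> real"
  assumes open_U: "open U" and convex_U: "convex U" and bounded_U: "bounded U"
    and U_nonempty: "U \<noteq> {}"
    and g_measurable [measurable]: "g \<in> borel_measurable borel"
    and g_outside: "\<And>x. x \<notin> U \<Longrightarrow> g x = 0"
    and g_square_integrable: "integrable lborel (\<lambda>x. (g x)\<^sup>2)"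
    and g_mean: "(\<integral>x. g x \<partial>lborel) = 0"
begin

definition vol :: real where "vol = measure lborel U"

lemma U_measurable [measurable]: "U \<in> sets borel"
  using open_U by simp

lemma emeasure_U: "emeasure lborel U = ennreal vol"
  unfolding vol_def using emeasure_bounded_finite[OF bounded_U]
  by (intro emeasure_eq_ennreal_measure) auto

lemma vol_pos: "vol > 0"
proof -
  have "emeasure lborel U \<noteq> 0"
    using open_not_negligible[OF open_U U_nonempty] open_U
    by (auto simp: negligible_iff_null_sets null_sets_def)
  then show ?thesis
    unfolding emeasure_U using ennreal_eq_0_iff linorder_not_le by blast
qed

text \<open>On \<open>U\<close>, which has finite measure, 2 |g| \<le> 1 + g^2 by expanding (|g| -
  1)^2 \<ge> 0.\<close>

lemma g_integrable: "integrable lborel g"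
proof -
  have "integrable lborel (\<lambda>x. indicator U x + (g x)\<^sup>2)"
    using emeasure_U g_square_integrable by (intro Bochner_Integration.integrable_add) auto
  moreover have "norm (g x) \<le> norm (indicator U x + (g x)\<^sup>2)" for x
  proof (cases "x \<in> U")
    case True
    have "0 \<le> (\<bar>g x\<bar> - 1)\<^sup>2" by simp
    then have "2 * \<bar>g x\<bar> \<le> 1 + (g x)\<^sup>2" by (simp add: power2_eq_square algebra_simps)
    then show ?thesis using True by (simp add: abs_if)
  qed (simp add: g_outside)
  ultimately show ?thesis
    by (intro Bochner_Integration.integrable_bound[of lborel _ g]) auto
qed

section \<open>The transport field and its kernel\<close>

abbreviation P :: "(real \<times> 'a) measure" where "P \<equiv> lborel \<Otimes>\<^sub>M lborel"

text \<open>The parameter p = (t, x) will be exchanged with a point y or z by Fubini, which needs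
  both factors to be sigma-finite; \<open>P\<close> is itself a Lebesgue measure.\<close>

sublocale PL: pair_sigma_finite P "lborel :: 'a measure"
  unfolding lborel_prod ..

text \<open>A pair (t, x) with t \<le> 1/2 parametrises the segments from y towards x; the point reached
  from y is z = (1 - t) y + t x, and \<open>origin (t, x) z\<close> recovers y from z.\<close>

definition origin :: "real \<times> 'a \<Rightarrow> 'a \<Rightarrow> 'a" where
  "origin p z = (1 / (1 - fst p)) *\<^sub>R (z - fst p *\<^sub>R snd p)"

text \<open>Up to the factor 1 / vol, this is the mass sent from y towards x; the indicator in t
  stops the motion at the midpoint.\<close>

definition wt :: "real \<times> 'a \<Rightarrow> 'a \<Rightarrow> real" where
  "wt p y = indicator {0..1/2} (fst p) * indicator U (snd p) * indicator U y * (g (snd p) - g y)"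

text \<open>For fixed p = (t, x) this is the push-forward of the flux \<open>wt p y\<close> times
  the velocity x - y under the map y \<mapsto> z = (1 - t) y + t x. The power of 1 - t is the
  Jacobian of that map.\<close>

definition kern :: "real \<times> 'a \<Rightarrow> 'a \<Rightarrow> 'a" where
  "kern p z = (wt p (origin p z) / (1 - fst p) ^ DIM('a)) *\<^sub>R (snd p - origin p z)"

definition transport :: "'a \<Rightarrow> 'a" where
  "transport z = (1 / vol) *\<^sub>R (\<integral>p. kern p z \<partial>P)"

text \<open>Stated for composed arguments, so that joint measurability can be derived over each of
  the product measures that occur later. The same holds for \<open>wt_measurable\<close> and
  \<open>kern_measurable\<close>.\<close>

lemma origin_measurable [measurable (raw)]:
  assumes "a \<in> M \<rightarrow>\<^sub>M P" and [measurable]: "b \<in> M \<rightarrow>\<^sub>M borel"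
  shows "(\<lambda>x. origin (a x) (b x)) \<in> borel_measurable M"
proof -
  \<comment> \<open>\<open>lborel\<close> and \<open>borel\<close> have the same measurable sets, so
    a map into \<open>P\<close> is also a map into the Borel product, where \<open>fst\<close> and
    \<open>snd\<close> can be handled.\<close>
  have [measurable]: "a \<in> M \<rightarrow>\<^sub>M borel \<Otimes>\<^sub>M borel"
    using assms(1) by (simp add: measurable_def sets_pair_measure space_pair_measure)
  show ?thesis unfolding origin_def by measurable
qed

lemma wt_measurable [measurable (raw)]:
  assumes "a \<in> M \<rightarrow>\<^sub>M P" and [measurable]: "b \<in> M \<rightarrow>\<^sub>M borel"
  shows "(\<lambda>x. wt (a x) (b x)) \<in> borel_measurable M"
proof -
  have [measurable]: "a \<in> M \<rightarrow>\<^sub>M borel \<Otimes>\<^sub>M borel"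
    using assms(1) by (simp add: measurable_def sets_pair_measure space_pair_measure)
  show ?thesis unfolding wt_def by measurable
qed

lemma kern_measurable [measurable (raw)]:
  assumes a [measurable]: "a \<in> M \<rightarrow>\<^sub>M P" and [measurable]: "b \<in> M \<rightarrow>\<^sub>M borel"
  shows "(\<lambda>x. kern (a x) (b x)) \<in> borel_measurable M"
proof -
  have [measurable]: "a \<in> M \<rightarrow>\<^sub>M borel \<Otimes>\<^sub>M borel"
    using a by (simp add: measurable_def sets_pair_measure space_pair_measure)
  show ?thesis unfolding kern_def by measurable
qed

lemma transport_measurable [measurable]: "transport \<in> borel_measurable borel"
  unfolding transport_def[abs_def] by measurable

lemma wt_eq_0: "fst p \<notin> {0..1/2} \<Longrightarrow> wt p y = 0"
  by (auto simp: wt_def)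

lemma origin_inverse:
  "fst p \<noteq> 1 \<Longrightarrow> (1 - fst p) *\<^sub>R origin p z + fst p *\<^sub>R snd p = z"
  by (simp add: origin_def)

text \<open>Convexity of \<open>U\<close> enters here: a nonzero kernel forces x and the origin y of
  z into \<open>U\<close>, and z lies on the segment between them.\<close>

lemma kern_outside: "kern p z = 0" if "z \<notin> U"
proof (rule ccontr)
  assume "kern p z \<noteq> 0"
  then have "wt p (origin p z) \<noteq> 0" by (auto simp: kern_def)
  then have *: "fst p \<in> {0..1/2}" "snd p \<in> U" "origin p z \<in> U"
    by (auto simp: wt_def indicator_def split: if_splits)
  then have "(1 - fst p) *\<^sub>R origin p z + fst p *\<^sub>R snd p \<in> U"
    using convex_U by (intro convexD) auto
  then show False using * that by (simp add: origin_inverse)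
qed

lemma transport_outside: "z \<notin> U \<Longrightarrow> transport z = 0"
  by (simp add: transport_def kern_outside)

section \<open>Substitution along segments and the square norm of the transport field\<close>

text \<open>Substitute z = t x + (1 - t) y, the map inverted by \<open>origin p\<close>. The
  restriction t \<le> 1/2 keeps the scaling factor 1 - t positive.\<close>

lemma nn_integral_origin:
  assumes [measurable]: "F \<in> borel_measurable borel" and t: "fst p \<in> {0..1/2}"
  shows "(\<integral>\<^sup>+z. F (origin p z) \<partial>lborel) = ennreal ((1 - fst p) ^ DIM('a)) * (\<integral>\<^sup>+y. F y \<partial>lborel)"
proof -
  let ?s = "1 - fst p"
  have s: "?s > 0" using t by auto
  have [measurable]: "origin p \<in> borel_measurable borel"
    unfolding origin_def[abs_def] by measurable
  have o: "origin p (fst p *\<^sub>R snd p + ?s *\<^sub>R y) = y" for y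
    using s by (simp add: origin_def)
  show ?thesis
    using s by (subst nn_integral_lborel_affine[of _ "?s" "fst p *\<^sub>R snd p"]) (simp_all add: o)
qed

lemma integral_origin:
  fixes F :: "'a \<Rightarrow> real"
  assumes [measurable]: "F \<in> borel_measurable borel" and t: "fst p \<in> {0..1/2}"
  shows "(\<integral>z. F (origin p z) \<partial>lborel) = (1 - fst p) ^ DIM('a) * (\<integral>y. F y \<partial>lborel)"
proof -
  let ?s = "1 - fst p"
  have s: "?s > 0" using t by auto
  have [measurable]: "origin p \<in> borel_measurable borel"
    unfolding origin_def[abs_def] by measurable
  have o: "origin p (fst p *\<^sub>R snd p + ?s *\<^sub>R y) = y" for y
    using s by (simp add: origin_def)
  show ?thesis
    using s by (subst integral_lborel_affine[of _ "?s" "fst p *\<^sub>R snd p"]) (simp_all add: o)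
qed

lemma dist_le_diameter: "x \<in> U \<Longrightarrow> y \<in> U \<Longrightarrow> norm (x - y) \<le> diameter U"
  using diameter_bounded_bound[OF bounded_U] by (simp add: dist_norm)

lemma diameter_nonneg: "0 \<le> diameter U"
  using diameter_ge_0[OF bounded_U] .

lemma wt_le: "\<bar>wt p y\<bar> * norm (snd p - y) \<le> diameter U * \<bar>wt p y\<bar>"
proof (cases "snd p \<in> U \<and> y \<in> U")
  case True
  then show ?thesis using dist_le_diameter mult_right_mono[of "norm (snd p - y)" "diameter U" "\<bar>wt p y\<bar>"]
    by (simp add: mult.commute)
qed (auto simp: wt_def)

text \<open>The pointwise bound (g x - g y)^2 \<le> 2 (g x)^2 + 2 (g y)^2 splits the double integral
  into two terms, each equal to 2 vol times the squared norm of g.\<close>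

lemma square_diff_nn_integral:
  "(\<integral>\<^sup>+x. \<integral>\<^sup>+y. ennreal (indicator U x * indicator U y * (g x - g y)\<^sup>2) \<partial>lborel \<partial>lborel)
     \<le> ennreal (4 * vol * (\<integral>x. (g x)\<^sup>2 \<partial>lborel))"
proof -
  let ?G = "\<integral>x. (g x)\<^sup>2 \<partial>lborel"
  have G: "(\<integral>\<^sup>+x. ennreal ((g x)\<^sup>2) \<partial>lborel) = ennreal ?G" and G0: "?G \<ge> 0"
    using g_square_integrable by (auto intro!: nn_integral_eq_integral)
  have iU: "(\<integral>\<^sup>+x. ennreal (indicator U x) \<partial>lborel) = ennreal vol"
    by (simp add: ennreal_indicator emeasure_U)
  have pt: "indicator U x * indicator U y * (g x - g y)\<^sup>2
      \<le> 2 * (g x)\<^sup>2 * indicator U y + 2 * indicator U x * (g y)\<^sup>2" for x y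
  proof -
    have "0 \<le> (g x + g y)\<^sup>2" by simp
    then have "(g x - g y)\<^sup>2 \<le> 2 * (g x)\<^sup>2 + 2 * (g y)\<^sup>2"
      by (simp add: power2_eq_square algebra_simps)
    then show ?thesis by (auto simp: indicator_def)
  qed
  have "(\<integral>\<^sup>+x. \<integral>\<^sup>+y. ennreal (indicator U x * indicator U y * (g x - g y)\<^sup>2) \<partial>lborel \<partial>lborel)
     \<le> (\<integral>\<^sup>+x. \<integral>\<^sup>+y. ennreal (2 * (g x)\<^sup>2) * ennreal (indicator U y)
           + ennreal (2 * indicator U x) * ennreal ((g y)\<^sup>2) \<partial>lborel \<partial>lborel)"
    using pt by (intro nn_integral_mono) (simp add: ennreal_mult[symmetric] ennreal_plus[symmetric] del: ennreal_plus)
  also have "\<dots> = (\<integral>\<^sup>+x. ennreal (2 * vol) * ennreal ((g x)\<^sup>2) + ennreal (2 * ?G) * ennreal (indicator U x) \<partial>lborel)"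
  proof (intro nn_integral_cong)
    fix x
    have "(\<integral>\<^sup>+y. ennreal (2 * (g x)\<^sup>2) * ennreal (indicator U y)
           + ennreal (2 * indicator U x) * ennreal ((g y)\<^sup>2) \<partial>lborel)
        = ennreal (2 * (g x)\<^sup>2) * ennreal vol + ennreal (2 * indicator U x) * ennreal ?G"
      by (simp add: nn_integral_add nn_integral_cmult G iU)
    also have "\<dots> = ennreal (2 * vol) * ennreal ((g x)\<^sup>2) + ennreal (2 * ?G) * ennreal (indicator U x)"
      using G0 vol_pos by (simp add: ennreal_mult[symmetric] mult_ac)
    finally show "(\<integral>\<^sup>+y. ennreal (2 * (g x)\<^sup>2) * ennreal (indicator U y)
           + ennreal (2 * indicator U x) * ennreal ((g y)\<^sup>2) \<partial>lborel) = \<dots>" .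
  qed
  also have "\<dots> = ennreal (2 * vol) * ennreal ?G + ennreal (2 * ?G) * ennreal vol"
    by (simp add: nn_integral_add nn_integral_cmult G iU)
  also have "\<dots> = ennreal (4 * vol * ?G)"
    using G0 vol_pos by (simp add: ennreal_mult[symmetric] ennreal_plus[symmetric] mult_ac del: ennreal_plus)
  finally show ?thesis .
qed

text \<open>The square of the kernel carries the Jacobian twice in the denominator and the
  substitution cancels one of them. The remaining (1 - t)^(-n) is at most 2^n for t \<le> 1/2, which
  is the origin of the factor 2^n in all later constants.\<close>

lemma kern_square:
  assumes t: "fst p \<in> {0..1/2}"
  shows "(\<integral>\<^sup>+z. ennreal ((norm (kern p z))\<^sup>2) \<partial>lborel)
     \<le> ennreal (2 ^ DIM('a) * (diameter U)\<^sup>2) *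
       (\<integral>\<^sup>+y. ennreal (indicator U (snd p) * indicator U y * (g (snd p) - g y)\<^sup>2) \<partial>lborel)"
proof -
  let ?s = "(1 - fst p) ^ DIM('a)" and ?h = "diameter U"
  have s: "?s > 0" using t by auto
  define B where "B y = indicator U (snd p) * indicator U y * (g (snd p) - g y)\<^sup>2" for y
  have [measurable]: "B \<in> borel_measurable borel" unfolding B_def by measurable
  have B0: "B y \<ge> 0" for y by (simp add: B_def)
  have k: "(norm (kern p z))\<^sup>2 \<le> ?h\<^sup>2 / ?s\<^sup>2 * B (origin p z)" for z
  proof -
    let ?y = "origin p z"
    have "(norm (kern p z))\<^sup>2 = (\<bar>wt p ?y\<bar> * norm (snd p - ?y))\<^sup>2 / ?s\<^sup>2"
      by (simp add: kern_def power_mult_distrib power_divide)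
    also have "\<dots> \<le> (?h * \<bar>wt p ?y\<bar>)\<^sup>2 / ?s\<^sup>2"
      using wt_le by (intro divide_right_mono power_mono) auto
    also have "(?h * \<bar>wt p ?y\<bar>)\<^sup>2 = ?h\<^sup>2 * B ?y"
      using t by (auto simp: wt_def B_def indicator_def power_mult_distrib)
    finally show ?thesis by simp
  qed
  have "(\<integral>\<^sup>+z. ennreal ((norm (kern p z))\<^sup>2) \<partial>lborel)
      \<le> (\<integral>\<^sup>+z. ennreal (?h\<^sup>2 / ?s\<^sup>2 * B (origin p z)) \<partial>lborel)"
    using k by (intro nn_integral_mono ennreal_leI)
  also have "\<dots> = ennreal ?s * (\<integral>\<^sup>+y. ennreal (?h\<^sup>2 / ?s\<^sup>2 * B y) \<partial>lborel)"
    using t by (intro nn_integral_origin) auto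
  also have "\<dots> = ennreal ?s * (ennreal (?h\<^sup>2 / ?s\<^sup>2) * (\<integral>\<^sup>+y. ennreal (B y) \<partial>lborel))"
  proof -
    have "(\<integral>\<^sup>+y. ennreal (c * B y) \<partial>lborel) = ennreal c * (\<integral>\<^sup>+y. ennreal (B y) \<partial>lborel)" if "c \<ge> 0" for c
      using B0 that by (simp add: ennreal_mult nn_integral_cmult)
    from this[of "?h\<^sup>2 / ?s\<^sup>2"] show ?thesis by simp
  qed
  also have "\<dots> = ennreal (?h\<^sup>2 / ?s) * (\<integral>\<^sup>+y. ennreal (B y) \<partial>lborel)"
    using s by (simp add: mult.assoc[symmetric] ennreal_mult[symmetric]) (simp add: power2_eq_square)
  also have "\<dots> \<le> ennreal (2 ^ DIM('a) * ?h\<^sup>2) * (\<integral>\<^sup>+y. ennreal (B y) \<partial>lborel)"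
  proof (intro mult_right_mono ennreal_leI)
    have "(1/2) ^ DIM('a) \<le> ?s" using t by (intro power_mono) auto
    then have "1 / ?s \<le> 2 ^ DIM('a)"
      using s by (simp add: field_simps power_divide)
    from mult_right_mono[OF this, of "?h\<^sup>2"] show "?h\<^sup>2 / ?s \<le> 2 ^ DIM('a) * ?h\<^sup>2" by simp
  qed simp
  finally show ?thesis by (simp add: B_def)
qed

text \<open>Cauchy-Schwarz in p over {0..1/2} \<times> U, a set of measure vol / 2, bounds the
  square of the field by an integral of squared kernels. Fubini then reduces the claim to
  \<open>kern_square\<close> for fixed p and to \<open>square_diff_nn_integral\<close>.\<close>

lemma transport_bound:
  "(\<integral>\<^sup>+z. ennreal ((norm (transport z))\<^sup>2) \<partial>lborel)
     \<le> ennreal (2 ^ DIM('a) * (diameter U)\<^sup>2 * (\<integral>x. (g x)\<^sup>2 \<partial>lborel))"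
proof -
  let ?G = "\<integral>x. (g x)\<^sup>2 \<partial>lborel"
  define A where "A = {0..1/2::real} \<times> U"
  have A_sets [measurable]: "A \<in> sets P" unfolding A_def by measurable
  have "emeasure P A = emeasure lborel {0..1/2::real} * emeasure lborel U"
    unfolding A_def by (rule lborel.emeasure_pair_measure_Times) auto
  then have eA: "emeasure P A = ennreal (vol / 2)"
    using vol_pos by (simp add: emeasure_U ennreal_mult''[symmetric] del: ennreal_half)
  have kA: "kern p z = 0" if "p \<notin> A" for p z
    using that by (auto simp: A_def kern_def wt_def split_beta mem_Times_iff)
  have pt: "ennreal ((norm (transport z))\<^sup>2) \<le> ennreal (1 / (2 * vol)) * (\<integral>\<^sup>+p. ennreal ((norm (kern p z))\<^sup>2) \<partial>P)" for z
  proof -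
    have [measurable]: "(\<lambda>p. kern p z) \<in> borel_measurable P" by measurable
    \<comment> \<open>If the kernel is not integrable in p at this z, the Bochner integral has the
      default value 0 and the bound is trivial.\<close>
    have "ennreal (norm (\<integral>p. kern p z \<partial>P)) \<le> (\<integral>\<^sup>+p. ennreal (norm (kern p z)) \<partial>P)"
      by (cases "integrable P (\<lambda>p. kern p z)")
         (auto intro: integral_norm_bound_ennreal simp: not_integrable_integral_eq)
    also have "\<dots> = (\<integral>\<^sup>+p. indicator A p * ennreal (norm (kern p z)) \<partial>P)"
      by (intro nn_integral_cong) (auto simp: indicator_def kA)
    finally have "(ennreal (norm (\<integral>p. kern p z \<partial>P)))\<^sup>2 \<le> (\<integral>\<^sup>+p. indicator A p * ennreal (norm (kern p z)) \<partial>P)\<^sup>2"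
      by (intro power_mono) auto
    also have "\<dots> \<le> (\<integral>\<^sup>+p. (indicator A p)\<^sup>2 \<partial>P) * (\<integral>\<^sup>+p. (ennreal (norm (kern p z)))\<^sup>2 \<partial>P)"
      by (intro Cauchy_Schwarz_nn_integral) auto
    also have "(\<integral>\<^sup>+p. (indicator A p)\<^sup>2 \<partial>P) = (\<integral>\<^sup>+p. indicator A p \<partial>P)"
      by (intro nn_integral_cong) (auto simp: indicator_def)
    also have "\<dots> = ennreal (vol / 2)"
      using eA by (simp only: nn_integral_indicator[OF A_sets])
    finally have *: "ennreal ((norm (\<integral>p. kern p z \<partial>P))\<^sup>2) \<le> ennreal (vol / 2) * (\<integral>\<^sup>+p. ennreal ((norm (kern p z))\<^sup>2) \<partial>P)"
      by (simp add: ennreal_power)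
    have "ennreal ((norm (transport z))\<^sup>2) = ennreal (1 / vol\<^sup>2) * ennreal ((norm (\<integral>p. kern p z \<partial>P))\<^sup>2)"
      using vol_pos by (simp add: transport_def power_divide ennreal_mult[symmetric])
    also have "\<dots> \<le> ennreal (1 / vol\<^sup>2) * (ennreal (vol / 2) * (\<integral>\<^sup>+p. ennreal ((norm (kern p z))\<^sup>2) \<partial>P))"
      by (intro mult_left_mono *) simp
    also have "\<dots> = ennreal (1 / (2 * vol)) * (\<integral>\<^sup>+p. ennreal ((norm (kern p z))\<^sup>2) \<partial>P)"
      using vol_pos by (simp add: mult.assoc[symmetric] ennreal_mult[symmetric])
        (simp add: power2_eq_square mult.commute)
    finally show ?thesis .
  qed
  define B where "B x y = ennreal (indicator U x * indicator U y * (g x - g y)\<^sup>2)" for x y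
  let ?c = "2 ^ DIM('a) * (diameter U)\<^sup>2"
  have [measurable]: "(\<lambda>x. \<integral>\<^sup>+y. B x y \<partial>lborel) \<in> borel_measurable borel"
    unfolding B_def by measurable
  have "(\<integral>\<^sup>+z. ennreal ((norm (transport z))\<^sup>2) \<partial>lborel)
      \<le> (\<integral>\<^sup>+z. ennreal (1 / (2 * vol)) * (\<integral>\<^sup>+p. ennreal ((norm (kern p z))\<^sup>2) \<partial>P) \<partial>lborel)"
    using pt by (intro nn_integral_mono)
  also have "\<dots> = ennreal (1 / (2 * vol)) * (\<integral>\<^sup>+z. \<integral>\<^sup>+p. ennreal ((norm (kern p z))\<^sup>2) \<partial>P \<partial>lborel)"
    by (intro nn_integral_cmult) measurable
  also have "(\<integral>\<^sup>+z. \<integral>\<^sup>+p. ennreal ((norm (kern p z))\<^sup>2) \<partial>P \<partial>lborel)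
      = (\<integral>\<^sup>+p. \<integral>\<^sup>+z. ennreal ((norm (kern p z))\<^sup>2) \<partial>lborel \<partial>P)"
    by (intro PL.Fubini') measurable
  also have "\<dots> \<le> (\<integral>\<^sup>+p. indicator {0..1/2} (fst p) * (ennreal ?c * (\<integral>\<^sup>+y. B (snd p) y \<partial>lborel)) \<partial>P)"
  proof (intro nn_integral_mono)
    fix p :: "real \<times> 'a"
    show "(\<integral>\<^sup>+z. ennreal ((norm (kern p z))\<^sup>2) \<partial>lborel)
        \<le> indicator {0..1/2} (fst p) * (ennreal ?c * (\<integral>\<^sup>+y. B (snd p) y \<partial>lborel))"
      using kern_square[of p] unfolding B_def
      by (cases "fst p \<in> {0..1/2}") (simp_all add: kern_def wt_eq_0)
  qed
  also have "\<dots> = (\<integral>\<^sup>+t. \<integral>\<^sup>+x. indicator {0..1/2::real} t * (ennreal ?c * (\<integral>\<^sup>+y. B x y \<partial>lborel)) \<partial>lborel \<partial>lborel)"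
    by (subst lborel.nn_integral_fst[symmetric]) auto
  also have "\<dots> = (\<integral>\<^sup>+t. (ennreal ?c * (\<integral>\<^sup>+x. \<integral>\<^sup>+y. B x y \<partial>lborel \<partial>lborel)) * indicator {0..1/2::real} t \<partial>lborel)"
    by (intro nn_integral_cong) (simp add: nn_integral_cmult, simp add: mult_ac)
  also have "\<dots> = (ennreal ?c * (\<integral>\<^sup>+x. \<integral>\<^sup>+y. B x y \<partial>lborel \<partial>lborel)) * ennreal (1/2)"
    by (simp add: nn_integral_cmult_indicator)
  also have "\<dots> \<le> (ennreal ?c * ennreal (4 * vol * ?G)) * ennreal (1/2)"
    using square_diff_nn_integral unfolding B_def by (intro mult_mono) auto
  \<comment> \<open>The factors 1 / (2 vol), 4 vol and the length 1/2 of the t-interval multiply to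
    1.\<close>
  also have "ennreal (1 / (2 * vol)) * \<dots> = ennreal (?c * ?G)"
    using vol_pos by (simp add: ennreal_mult[symmetric] del: ennreal_half)
  finally show ?thesis by (simp add: mult_left_mono)
qed

section \<open>Integrability of the weights and kernels\<close>

text \<open>The factor of \<open>wt\<close> that is free of t, separated because it is antisymmetric
  in x and y.\<close>

definition gdiff :: "'a \<Rightarrow> 'a \<Rightarrow> real" where
  "gdiff x y = indicator U x * indicator U y * (g x - g y)"

lemma gdiff_measurable [measurable (raw)]:
  assumes [measurable]: "a \<in> M \<rightarrow>\<^sub>M borel" "b \<in> M \<rightarrow>\<^sub>M borel"
  shows "(\<lambda>x. gdiff (a x) (b x)) \<in> borel_measurable M"
  unfolding gdiff_def by measurable

lemma wt_gdiff: "wt p y = indicator {0..1/2} (fst p) * gdiff (snd p) y"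
  by (simp add: wt_def gdiff_def)

text \<open>By the triangle inequality the double integral is at most 2 vol times the integral of
  |g|.\<close>

lemma nn_integral_gdiff_finite:
  "(\<integral>\<^sup>+x. \<integral>\<^sup>+y. ennreal \<bar>gdiff x y\<bar> \<partial>lborel \<partial>lborel) < \<infinity>"
proof -
  have G: "(\<integral>\<^sup>+x. ennreal \<bar>g x\<bar> \<partial>lborel) < \<infinity>"
    using g_integrable by (simp add: integrable_iff_bounded)
  have iU: "(\<integral>\<^sup>+x. ennreal (indicator U x) \<partial>lborel) = ennreal vol"
    by (simp add: ennreal_indicator emeasure_U)
  have pt: "\<bar>gdiff x y\<bar> \<le> \<bar>g x\<bar> * indicator U y + indicator U x * \<bar>g y\<bar>" for x y
    by (auto simp: gdiff_def indicator_def)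
  have "(\<integral>\<^sup>+x. \<integral>\<^sup>+y. ennreal \<bar>gdiff x y\<bar> \<partial>lborel \<partial>lborel)
     \<le> (\<integral>\<^sup>+x. \<integral>\<^sup>+y. ennreal \<bar>g x\<bar> * ennreal (indicator U y)
           + ennreal (indicator U x) * ennreal \<bar>g y\<bar> \<partial>lborel \<partial>lborel)"
    using pt by (intro nn_integral_mono)
      (simp add: ennreal_mult[symmetric] ennreal_plus[symmetric] del: ennreal_plus)
  also have "\<dots> = (\<integral>\<^sup>+x. ennreal \<bar>g x\<bar> * ennreal vol + ennreal (indicator U x) * (\<integral>\<^sup>+y. ennreal \<bar>g y\<bar> \<partial>lborel) \<partial>lborel)"
    by (intro nn_integral_cong) (simp add: nn_integral_add nn_integral_cmult iU)
  also have "\<dots> = (\<integral>\<^sup>+x. ennreal \<bar>g x\<bar> \<partial>lborel) * ennreal vol + ennreal vol * (\<integral>\<^sup>+y. ennreal \<bar>g y\<bar> \<partial>lborel)"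
    by (simp add: nn_integral_add nn_integral_multc iU)
  also have "\<dots> < \<infinity>"
    using G by (simp add: ennreal_mult_less_top)
  finally show ?thesis .
qed

lemma gdiff_integrable: "integrable (lborel \<Otimes>\<^sub>M lborel) (\<lambda>(x, y). gdiff x y)"
proof (rule integrableI_bounded)
  show "(\<integral>\<^sup>+q. ennreal (norm (case q of (x, y) \<Rightarrow> gdiff x y)) \<partial>(lborel \<Otimes>\<^sub>M lborel)) < \<infinity>"
    using nn_integral_gdiff_finite by (subst lborel.nn_integral_fst[symmetric]) auto
qed measurable

lemma wt_integrable: "integrable (P \<Otimes>\<^sub>M lborel) (\<lambda>(p, y). wt p y)"
proof (rule integrableI_bounded)
  have "(\<integral>\<^sup>+q. ennreal (norm (case q of (p, y) \<Rightarrow> wt p y)) \<partial>(P \<Otimes>\<^sub>M lborel))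
      = (\<integral>\<^sup>+p. \<integral>\<^sup>+y. ennreal \<bar>wt p y\<bar> \<partial>lborel \<partial>P)"
    by (subst lborel.nn_integral_fst[symmetric]) auto
  also have "\<dots> = (\<integral>\<^sup>+p. indicator {0..1/2} (fst p) * (\<integral>\<^sup>+y. ennreal \<bar>gdiff (snd p) y\<bar> \<partial>lborel) \<partial>P)"
    by (intro nn_integral_cong) (auto simp: wt_gdiff indicator_def)
  also have "\<dots> = (\<integral>\<^sup>+t. \<integral>\<^sup>+x. indicator {0..1/2::real} t * (\<integral>\<^sup>+y. ennreal \<bar>gdiff x y\<bar> \<partial>lborel) \<partial>lborel \<partial>lborel)"
    by (subst lborel.nn_integral_fst[symmetric]) auto
  also have "\<dots> = (\<integral>\<^sup>+t. (\<integral>\<^sup>+x. \<integral>\<^sup>+y. ennreal \<bar>gdiff x y\<bar> \<partial>lborel \<partial>lborel) * indicator {0..1/2::real} t \<partial>lborel)"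
    by (intro nn_integral_cong) (simp add: nn_integral_cmult mult_ac)
  also have "\<dots> = (\<integral>\<^sup>+x. \<integral>\<^sup>+y. ennreal \<bar>gdiff x y\<bar> \<partial>lborel \<partial>lborel) * ennreal (1/2)"
    by (simp add: nn_integral_cmult_indicator)
  also have "\<dots> < \<infinity>"
    using nn_integral_gdiff_finite by (simp add: ennreal_mult_less_top del: ennreal_half)
  finally show "(\<integral>\<^sup>+q. ennreal (norm (case q of (p, y) \<Rightarrow> wt p y)) \<partial>(P \<Otimes>\<^sub>M lborel)) < \<infinity>" .
qed measurable

text \<open>For fixed p the substitution cancels the single Jacobian exactly, so the L1 norm of the
  kernel is at most \<open>diameter U\<close> times that of the weight. This justifies Fubini for
  the signed integrals in the divergence identity.\<close>

lemma kern_integrable: "integrable (P \<Otimes>\<^sub>M lborel) (\<lambda>(p, z). kern p z)"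
proof (rule integrableI_bounded)
  let ?h = "diameter U"
  have pt: "(\<integral>\<^sup>+z. ennreal (norm (kern p z)) \<partial>lborel) \<le> ennreal ?h * (\<integral>\<^sup>+y. ennreal \<bar>wt p y\<bar> \<partial>lborel)" for p
  proof (cases "fst p \<in> {0..1/2}")
    case True
    let ?s = "(1 - fst p) ^ DIM('a)"
    have s: "?s > 0" using True by auto
    have [measurable]: "(\<lambda>y. wt p y) \<in> borel_measurable borel"
      by (intro wt_measurable measurable_const measurable_ident_sets[OF refl]) (simp add: space_pair_measure)
    have "norm (kern p z) \<le> ?h / ?s * \<bar>wt p (origin p z)\<bar>" for z
      using s divide_right_mono[OF wt_le[of p "origin p z"], of ?s] True by (simp add: kern_def)
    then have "(\<integral>\<^sup>+z. ennreal (norm (kern p z)) \<partial>lborel) \<le> (\<integral>\<^sup>+z. ennreal (?h / ?s) * ennreal \<bar>wt p (origin p z)\<bar> \<partial>lborel)"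
      using s diameter_nonneg by (intro nn_integral_mono) (simp add: ennreal_mult[symmetric])
    also have "\<dots> = ennreal ?s * (\<integral>\<^sup>+y. ennreal (?h / ?s) * ennreal \<bar>wt p y\<bar> \<partial>lborel)"
      using True by (intro nn_integral_origin) auto
    also have "\<dots> = ennreal ?h * (\<integral>\<^sup>+y. ennreal \<bar>wt p y\<bar> \<partial>lborel)"
      using s True diameter_nonneg
      by (subst nn_integral_cmult) (simp_all add: mult.assoc[symmetric] ennreal_mult[symmetric])
    finally show ?thesis .
  qed (simp add: kern_def wt_eq_0)
  have "(\<integral>\<^sup>+q. ennreal (norm (case q of (p, z) \<Rightarrow> kern p z)) \<partial>(P \<Otimes>\<^sub>M lborel))
      = (\<integral>\<^sup>+p. \<integral>\<^sup>+z. ennreal (norm (kern p z)) \<partial>lborel \<partial>P)"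
    by (subst lborel.nn_integral_fst[symmetric]) auto
  also have "\<dots> \<le> (\<integral>\<^sup>+p. ennreal ?h * (\<integral>\<^sup>+y. ennreal \<bar>wt p y\<bar> \<partial>lborel) \<partial>P)"
    by (intro nn_integral_mono pt)
  also have "\<dots> = ennreal ?h * (\<integral>\<^sup>+p. \<integral>\<^sup>+y. ennreal \<bar>wt p y\<bar> \<partial>lborel \<partial>P)"
    by (intro nn_integral_cmult) measurable
  also have "(\<integral>\<^sup>+p. \<integral>\<^sup>+y. ennreal \<bar>wt p y\<bar> \<partial>lborel \<partial>P) = (\<integral>\<^sup>+q. ennreal (norm (case q of (p, y) \<Rightarrow> wt p y)) \<partial>(P \<Otimes>\<^sub>M lborel))"
    by (subst lborel.nn_integral_fst[symmetric]) auto
  also have "ennreal ?h * \<dots> < \<infinity>"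
    using wt_integrable by (simp add: ennreal_mult_less_top integrable_iff_bounded)
  finally show "(\<integral>\<^sup>+q. ennreal (norm (case q of (p, z) \<Rightarrow> kern p z)) \<partial>(P \<Otimes>\<^sub>M lborel)) < \<infinity>" .
qed measurable

section \<open>The divergence of the transport field\<close>

text \<open>The midpoint term vanishes by antisymmetry, which is why only the half of each segment
  with t \<le> 1/2, where the change of variables y \<mapsto> z is nondegenerate, is needed.\<close>

lemma midpoint_identity:
  fixes \<phi> :: "'a \<Rightarrow> real"
  assumes [measurable]: "\<phi> \<in> borel_measurable borel" and bd: "\<And>x. \<bar>\<phi> x\<bar> \<le> B"
  shows "(\<integral>y. \<integral>x. gdiff x y * (\<phi> ((1/2) *\<^sub>R (x + y)) - \<phi> y) \<partial>lborel \<partial>lborel)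
    = vol * (\<integral>y. g y * \<phi> y \<partial>lborel)"
proof -
  define A where "A x y = gdiff x y * \<phi> ((1/2) *\<^sub>R (x + y))" for x y
  have [measurable]: "(\<lambda>(x, y). A x y) \<in> borel_measurable (lborel \<Otimes>\<^sub>M lborel)"
    unfolding A_def by measurable
  have bnd: "norm (c * \<phi> z) \<le> norm (B * c)" for c z
    using mult_right_mono[OF bd[of z], of "\<bar>c\<bar>"] bd[of z] by (simp add: abs_mult mult.commute)
  have A: "integrable (lborel \<Otimes>\<^sub>M lborel) (\<lambda>(x, y). A x y)"
    using integrable_mult_right[OF gdiff_integrable, of B]
    by (rule Bochner_Integration.integrable_bound) (auto simp: A_def bnd simp del: norm_mult real_norm_def)
  have anti: "A x y = - A y x" for x y
    by (simp add: A_def gdiff_def add.commute algebra_simps)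
  have "(\<integral>y. \<integral>x. A x y \<partial>lborel \<partial>lborel) = (\<integral>x. \<integral>y. A x y \<partial>lborel \<partial>lborel)"
    by (rule lborel_pair.Fubini_integral[OF A])
  also have "\<dots> = - (\<integral>x. \<integral>y. A y x \<partial>lborel \<partial>lborel)"
    by (subst anti) simp
  finally have A0: "(\<integral>y. \<integral>x. A x y \<partial>lborel \<partial>lborel) = 0" by simp
  have iU: "integrable lborel (indicat_real U)"
    using emeasure_U by (intro integrable_real_indicator) auto
  have d: "gdiff x y = indicator U y * (g x - g y * indicator U x)" for x y
    using g_outside by (auto simp: gdiff_def indicator_def)
  have gi: "integrable lborel (\<lambda>x. gdiff x y)" for y
    unfolding d using iU g_integrable by simp
  \<comment> \<open>This is where the mean zero condition is used: g x integrates to 0, and only the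
    term with g y survives.\<close>
  have gI: "(\<integral>x. gdiff x y \<partial>lborel) = - vol * g y" for y
    unfolding d using iU g_integrable g_mean g_outside[of y]
    by (cases "y \<in> U") (simp_all add: vol_def)
  have Ai: "integrable lborel (\<lambda>x. A x y)" for y
    using integrable_mult_right[OF gi, of B y]
    by (rule Bochner_Integration.integrable_bound) (auto simp: A_def bnd simp del: norm_mult real_norm_def)
  have "integrable lborel (\<lambda>y. g y * \<phi> y)"
    using integrable_mult_right[OF g_integrable, of B]
    by (rule Bochner_Integration.integrable_bound) (auto simp: bnd simp del: norm_mult real_norm_def)
  moreover have "(\<integral>x. gdiff x y * (\<phi> ((1/2) *\<^sub>R (x + y)) - \<phi> y) \<partial>lborel)
      = (\<integral>x. A x y \<partial>lborel) + vol * (g y * \<phi> y)" for y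
  proof -
    have "(\<integral>x. gdiff x y * (\<phi> ((1/2) *\<^sub>R (x + y)) - \<phi> y) \<partial>lborel) = (\<integral>x. A x y - gdiff x y * \<phi> y \<partial>lborel)"
      by (simp add: A_def right_diff_distrib)
    also have "\<dots> = (\<integral>x. A x y \<partial>lborel) - (\<integral>x. gdiff x y \<partial>lborel) * \<phi> y"
      using Ai gi by simp
    finally show ?thesis by (simp add: gI)
  qed
  ultimately show ?thesis
    using A0 lborel_pair.integrable_snd[OF A] by simp
qed

text \<open>This is the weak form of div \<open>transport\<close> = - g, with F the gradient of
  \<phi>. After Fubini and the substitution z \<mapsto> y, the t-integral is the fundamental theorem
  of calculus for \<phi> on the segment from y to the midpoint of x and y;
  \<open>midpoint_identity\<close> evaluates what remains.\<close>

lemma transport_divergence: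
  fixes \<phi> :: "'a \<Rightarrow> real" and F :: "'a \<Rightarrow> 'a"
  assumes D: "\<And>x. (\<phi> has_derivative (\<lambda>v. F x \<bullet> v)) (at x)"
    and contF: "continuous_on UNIV F"
    and bdF: "\<And>x. norm (F x) \<le> B" and bd: "\<And>x. \<bar>\<phi> x\<bar> \<le> B"
  shows "(\<integral>z. F z \<bullet> transport z \<partial>lborel) = (\<integral>x. g x * \<phi> x \<partial>lborel)"
proof -
  have [measurable]: "F \<in> borel_measurable borel"
    using contF by (rule borel_measurable_continuous_onI)
  have "continuous_on UNIV \<phi>"
    using D by (meson continuous_at_imp_continuous_on has_derivative_continuous)
  then have phi [measurable]: "\<phi> \<in> borel_measurable borel"
    by (rule borel_measurable_continuous_onI)
  have B0: "B \<ge> 0" using bd[of 0] by simp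
  have kF: "integrable (P \<Otimes>\<^sub>M lborel) (\<lambda>(p, z). F z \<bullet> kern p z)"
  proof (rule Bochner_Integration.integrable_bound)
    show "integrable (P \<Otimes>\<^sub>M lborel) (\<lambda>q. B * norm (case q of (p, z) \<Rightarrow> kern p z))"
      using kern_integrable by (intro integrable_mult_right integrable_norm)
    show "AE q in P \<Otimes>\<^sub>M lborel. norm (case q of (p, z) \<Rightarrow> F z \<bullet> kern p z)
        \<le> norm (B * norm (case q of (p, z) \<Rightarrow> kern p z))"
      using B0 bdF by (intro AE_I2)
        (auto intro!: order_trans[OF Cauchy_Schwarz_ineq2] mult_right_mono simp: abs_mult)
  qed measurable
  \<comment> \<open>The integrand F \<bullet> \<open>kern\<close> pulled back to the starting point
    y, with the Jacobian removed.\<close>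
  define W where "W p y = wt p y * (F ((1 - fst p) *\<^sub>R y + fst p *\<^sub>R snd p) \<bullet> (snd p - y))" for p y
  have W_measurable [measurable (raw)]:
    "(\<lambda>x. W (a x) (b x)) \<in> borel_measurable M" if [measurable]: "a \<in> M \<rightarrow>\<^sub>M P" "b \<in> M \<rightarrow>\<^sub>M borel" for a b and M :: "'m measure"
  proof -
    have [measurable]: "a \<in> M \<rightarrow>\<^sub>M borel \<Otimes>\<^sub>M borel"
      using that by (simp add: measurable_def sets_pair_measure space_pair_measure)
    show ?thesis unfolding W_def by measurable
  qed
  have WI: "integrable (P \<Otimes>\<^sub>M lborel) (\<lambda>(p, y). W p y)"
  proof (rule Bochner_Integration.integrable_bound)
    show "integrable (P \<Otimes>\<^sub>M lborel) (\<lambda>q. B * diameter U * (case q of (p, y) \<Rightarrow> wt p y))"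
      using wt_integrable by (intro integrable_mult_right)
    have "\<bar>W p y\<bar> \<le> \<bar>B * diameter U * wt p y\<bar>" for p y
    proof -
      have "\<bar>W p y\<bar> \<le> \<bar>wt p y\<bar> * (B * norm (snd p - y))"
        unfolding W_def abs_mult
        by (intro mult_left_mono order_trans[OF Cauchy_Schwarz_ineq2] mult_right_mono bdF) auto
      also have "\<dots> = B * (\<bar>wt p y\<bar> * norm (snd p - y))" by simp
      also have "\<dots> \<le> B * (diameter U * \<bar>wt p y\<bar>)" by (intro mult_left_mono wt_le B0)
      finally show ?thesis using B0 diameter_nonneg by (simp add: abs_mult)
    qed
    then show "AE q in P \<Otimes>\<^sub>M lborel. norm (case q of (p, y) \<Rightarrow> W p y)
        \<le> norm (B * diameter U * (case q of (p, y) \<Rightarrow> wt p y))" by auto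
  qed measurable
  have sub: "(\<integral>z. F z \<bullet> kern p z \<partial>lborel) = (\<integral>y. W p y \<partial>lborel)" for p
  proof (cases "fst p \<in> {0..1/2}")
    case True
    let ?s = "(1 - fst p) ^ DIM('a)"
    have s: "?s > 0" "fst p \<noteq> 1" using True by auto
    have [measurable]: "W p \<in> borel_measurable borel"
      by (intro W_measurable measurable_const measurable_ident_sets[OF refl]) (simp add: space_pair_measure)
    have "(\<integral>z. F z \<bullet> kern p z \<partial>lborel) = (\<integral>z. W p (origin p z) / ?s \<partial>lborel)"
      by (intro Bochner_Integration.integral_cong refl) (simp add: W_def kern_def origin_inverse[OF s(2)])
    also have "\<dots> = ?s * (\<integral>y. W p y / ?s \<partial>lborel)"
      using True by (intro integral_origin) auto
    finally show ?thesis using s by simp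
  qed (simp add: kern_def W_def wt_eq_0)
  have ftc: "(\<integral>t. W (t, x) y \<partial>lborel) = gdiff x y * (\<phi> ((1/2) *\<^sub>R (x + y)) - \<phi> y)" for x y
  proof -
    let ?l = "\<lambda>t::real. (1 - t) *\<^sub>R y + t *\<^sub>R x"
    have "(\<integral>t. indicator {0..1/2} t *\<^sub>R (F (?l t) \<bullet> (x - y)) \<partial>lborel) = \<phi> (?l (1/2)) - \<phi> (?l 0)"
    proof (rule integral_FTC_atLeastAtMost)
      fix t :: real
      have l: "(?l has_derivative (\<lambda>h. h *\<^sub>R (x - y))) (at t within {0..1/2})"
        by (auto intro!: derivative_eq_intros simp: algebra_simps)
      show "((\<lambda>t. \<phi> (?l t)) has_vector_derivative F (?l t) \<bullet> (x - y)) (at t within {0..1/2})"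
        unfolding has_vector_derivative_def
        using has_derivative_compose[OF l D] by simp
    next
      show "continuous_on {0..1/2} (\<lambda>t. F (?l t) \<bullet> (x - y))"
        by (intro continuous_intros continuous_on_compose2[OF contF]) auto
    qed simp
    moreover have "W (t, x) y = gdiff x y * (indicator {0..1/2} t *\<^sub>R (F (?l t) \<bullet> (x - y)))" for t
      by (simp add: W_def wt_gdiff)
    moreover have "?l (1/2) = (1/2) *\<^sub>R (x + y)" by (simp add: algebra_simps)
    ultimately show ?thesis by simp
  qed
  have "(\<integral>z. F z \<bullet> transport z \<partial>lborel) = (\<integral>z. (1 / vol) * (\<integral>p. F z \<bullet> kern p z \<partial>P) \<partial>lborel)"
  proof (rule integral_cong_AE)
    \<comment> \<open>The inner product with F z passes through the Bochner integral where the
      kernel is integrable in p, which holds for almost every z.\<close>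
    show "AE z in lborel. F z \<bullet> transport z = 1 / vol * (\<integral>p. F z \<bullet> kern p z \<partial>P)"
      using PL.AE_integrable_snd[OF kern_integrable]
      by eventually_elim (simp add: transport_def)
  qed measurable
  also have "\<dots> = (1 / vol) * (\<integral>z. \<integral>p. F z \<bullet> kern p z \<partial>P \<partial>lborel)"
    by simp
  also have "(\<integral>z. \<integral>p. F z \<bullet> kern p z \<partial>P \<partial>lborel) = (\<integral>p. \<integral>z. F z \<bullet> kern p z \<partial>lborel \<partial>P)"
    by (rule PL.Fubini_integral[OF kF])
  also have "\<dots> = (\<integral>p. \<integral>y. W p y \<partial>lborel \<partial>P)"
    by (simp add: sub)
  also have "\<dots> = (\<integral>y. \<integral>p. W p y \<partial>P \<partial>lborel)"
    by (rule PL.Fubini_integral[OF WI, symmetric])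
  also have "\<dots> = (\<integral>y. \<integral>x. \<integral>t. W (t, x) y \<partial>lborel \<partial>lborel \<partial>lborel)"
  proof (rule integral_cong_AE)
    show "AE y in lborel. (\<integral>p. W p y \<partial>P) = (\<integral>x. \<integral>t. W (t, x) y \<partial>lborel \<partial>lborel)"
      using PL.AE_integrable_snd[OF WI]
    proof eventually_elim
      case (elim y)
      then show ?case
        using lborel_pair.integral_snd[of "\<lambda>t x. W (t, x) y"] by (simp add: split_beta')
    qed
  qed measurable
  also have "\<dots> = vol * (\<integral>y. g y * \<phi> y \<partial>lborel)"
    unfolding ftc by (rule midpoint_identity[OF phi bd])
  finally show ?thesis using vol_pos by simp
qed

end

section \<open>Inner products and differences in the L2 spaces\<close>

text \<open>Deduced from the inequality for nonnegative integrals, applied to the pointwise norms.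
  The step from the Bochner integral to nonnegative integrals also covers its default value
  0.\<close>

lemma Cauchy_Schwarz_integral:
  fixes f g :: "'a \<Rightarrow> 'b::euclidean_space"
  assumes [measurable]: "f \<in> borel_measurable M" "g \<in> borel_measurable M"
    and f: "integrable M (\<lambda>x. (norm (f x))\<^sup>2)" and g: "integrable M (\<lambda>x. (norm (g x))\<^sup>2)"
  shows "\<bar>\<integral>x. f x \<bullet> g x \<partial>M\<bar> \<le> sqrt (\<integral>x. (norm (f x))\<^sup>2 \<partial>M) * sqrt (\<integral>x. (norm (g x))\<^sup>2 \<partial>M)"
proof -
  let ?A = "\<integral>x. (norm (f x))\<^sup>2 \<partial>M" and ?B = "\<integral>x. (norm (g x))\<^sup>2 \<partial>M"
  have nn: "(\<integral>\<^sup>+x. (ennreal (norm (h x)))\<^sup>2 \<partial>M) = ennreal (\<integral>x. (norm (h x))\<^sup>2 \<partial>M)"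
    if "integrable M (\<lambda>x. (norm (h x))\<^sup>2)" for h :: "'a \<Rightarrow> 'b"
    using nn_integral_eq_integral[OF that] by (simp add: ennreal_power)
  have "ennreal \<bar>\<integral>x. f x \<bullet> g x \<partial>M\<bar> \<le> (\<integral>\<^sup>+x. ennreal (norm (f x \<bullet> g x)) \<partial>M)"
    using integral_norm_bound_ennreal[of M "\<lambda>x. f x \<bullet> g x"]
    by (cases "integrable M (\<lambda>x. f x \<bullet> g x)") (simp_all add: not_integrable_integral_eq)
  also have "\<dots> \<le> (\<integral>\<^sup>+x. ennreal (norm (f x)) * ennreal (norm (g x)) \<partial>M)"
    by (intro nn_integral_mono) (simp add: ennreal_mult[symmetric] Cauchy_Schwarz_ineq2)
  finally have "(ennreal \<bar>\<integral>x. f x \<bullet> g x \<partial>M\<bar>)\<^sup>2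
      \<le> (\<integral>\<^sup>+x. ennreal (norm (f x)) * ennreal (norm (g x)) \<partial>M)\<^sup>2"
    by (intro power_mono) auto
  also have "\<dots> \<le> (\<integral>\<^sup>+x. (ennreal (norm (f x)))\<^sup>2 \<partial>M) * (\<integral>\<^sup>+x. (ennreal (norm (g x)))\<^sup>2 \<partial>M)"
    by (intro Cauchy_Schwarz_nn_integral) auto
  also have "\<dots> = ennreal (?A * ?B)"
    by (simp add: nn f g ennreal_mult)
  finally have "(\<integral>x. f x \<bullet> g x \<partial>M)\<^sup>2 \<le> ?A * ?B"
    by (simp add: ennreal_power)
  then have "\<bar>\<integral>x. f x \<bullet> g x \<partial>M\<bar> \<le> sqrt (?A * ?B)"
    by (intro real_le_rsqrt) simp
  then show ?thesis by (simp add: real_sqrt_mult)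
qed

lemma integrable_inner_L2:
  fixes f g :: "'a \<Rightarrow> 'b::euclidean_space"
  assumes [measurable]: "f \<in> borel_measurable M" "g \<in> borel_measurable M"
    and "integrable M (\<lambda>x. (norm (f x))\<^sup>2)" "integrable M (\<lambda>x. (norm (g x))\<^sup>2)"
  shows "integrable M (\<lambda>x. f x \<bullet> g x)"
proof (rule Bochner_Integration.integrable_bound)
  show "integrable M (\<lambda>x. (norm (f x))\<^sup>2 + (norm (g x))\<^sup>2)"
    using assms by simp
  have "\<bar>f x \<bullet> g x\<bar> \<le> (norm (f x))\<^sup>2 + (norm (g x))\<^sup>2" for x
  proof -
    have "\<bar>f x \<bullet> g x\<bar> \<le> norm (f x) * norm (g x)" by (rule Cauchy_Schwarz_ineq2)
    also have "\<dots> \<le> (norm (f x))\<^sup>2 + (norm (g x))\<^sup>2"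
      using sum_squares_bound[of "norm (f x)" "norm (g x)"] mult_nonneg_nonneg[OF norm_ge_zero[of "f x"] norm_ge_zero[of "g x"]]
      by linarith
    finally show ?thesis .
  qed
  then show "AE x in M. norm (f x \<bullet> g x) \<le> norm ((norm (f x))\<^sup>2 + (norm (g x))\<^sup>2)"
    by (intro AE_I2) simp
qed measurable

lemma L2_mult_integrable: "f \<in> L2 S \<Longrightarrow> g \<in> L2 S \<Longrightarrow> integrable (lebesgue_on S) (\<lambda>x. f x * g x)"
  using integrable_inner_L2[of f "lebesgue_on S" g] by (simp add: L2_def)

lemma L2vec_inner_integrable:
  "s \<in> L2vec S \<Longrightarrow> t \<in> L2vec S \<Longrightarrow> integrable (lebesgue_on S) (\<lambda>x. s x \<bullet> t x)"
  using integrable_inner_L2[of s "lebesgue_on S" t] by (simp add: L2vec_def)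

lemma L2_diff: "(\<lambda>x. f x - g x) \<in> L2 S" if "f \<in> L2 S" "g \<in> L2 S"
proof -
  have "integrable (lebesgue_on S) (\<lambda>x. (f x)\<^sup>2 - 2 * (f x * g x) + (g x)\<^sup>2)"
    using that L2_mult_integrable[OF that] by (simp add: L2_def)
  then show ?thesis using that by (auto simp: L2_def power2_diff algebra_simps intro: borel_measurable_diff)
qed

lemma L2vec_diff: "(\<lambda>x. s x - t x) \<in> L2vec S" if "s \<in> L2vec S" "t \<in> L2vec S"
proof -
  have "integrable (lebesgue_on S) (\<lambda>x. s x \<bullet> s x - 2 * (s x \<bullet> t x) + t x \<bullet> t x)"
    using that L2vec_inner_integrable[OF that] L2vec_inner_integrable[OF that(1,1)] L2vec_inner_integrable[OF that(2,2)] by simp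
  moreover have "(norm (s x - t x))\<^sup>2 = s x \<bullet> s x - 2 * (s x \<bullet> t x) + t x \<bullet> t x" for x
    by (simp add: power2_norm_eq_inner inner_diff_left inner_diff_right inner_commute)
  ultimately show ?thesis using that by (auto simp: L2vec_def intro: borel_measurable_diff)
qed

section \<open>Passing between a subset and the whole space\<close>

lemma integral_lebesgue_on_eq_lebesgue:
  fixes h :: "'a::euclidean_space \<Rightarrow> 'b::{banach, second_countable_topology}"
  assumes S: "S \<in> sets lebesgue" and h: "\<And>x. x \<notin> S \<Longrightarrow> h x = 0"
  shows "integral\<^sup>L (lebesgue_on S) h = integral\<^sup>L lebesgue h"
    and "integrable (lebesgue_on S) h \<longleftrightarrow> integrable lebesgue h"
    and "h \<in> borel_measurable (lebesgue_on S) \<longleftrightarrow> h \<in> borel_measurable lebesgue"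
proof -
  have "(\<lambda>x. indicator S x *\<^sub>R h x) = h"
    using h by (auto simp: indicator_def)
  then show "integral\<^sup>L (lebesgue_on S) h = integral\<^sup>L lebesgue h"
    "integrable (lebesgue_on S) h \<longleftrightarrow> integrable lebesgue h"
    "h \<in> borel_measurable (lebesgue_on S) \<longleftrightarrow> h \<in> borel_measurable lebesgue"
    using S by (simp_all add: integral_restrict_space integrable_restrict_space borel_measurable_restrict_space_iff)
qed

lemma borel_measurable_indicator_open:
  fixes U :: "'a::euclidean_space set"
  shows "open U \<Longrightarrow> indicat_real U \<in> borel_measurable (lebesgue_on S)"
  by (intro measurable_restrict_space1 measurable_completion) simp

lemma integrable_indicator_open_mult:
  fixes U :: "'a::euclidean_space set" and h :: "'a \<Rightarrow> real"
  assumes "open U" and h: "integrable (lebesgue_on S) h"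
  shows "integrable (lebesgue_on S) (\<lambda>x. indicator U x * h x)"
  using h
proof (rule Bochner_Integration.integrable_bound)
  show "(\<lambda>x. indicator U x * h x) \<in> borel_measurable (lebesgue_on S)"
    using borel_measurable_indicator_open[OF assms(1)] h by (intro borel_measurable_times) auto
  show "AE x in lebesgue_on S. norm (indicator U x * h x) \<le> norm (h x)"
    by (intro AE_I2) (simp add: indicator_def)
qed

section \<open>Gradients of test functions\<close>

lemma continuous_compact_support_bounded:
  fixes f :: "'a::topological_space \<Rightarrow> 'b::real_normed_vector"
  assumes "continuous_on UNIV f" "compact K" "\<And>x. x \<notin> K \<Longrightarrow> f x = 0"
  obtains B where "\<And>x. norm (f x) \<le> B"
proof -
  have "compact (f ` K)"
    using assms by (meson compact_continuous_image continuous_on_subset subset_UNIV)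
  then obtain B where "\<forall>y\<in>f ` K. norm y \<le> B"
    using compact_imp_bounded bounded_iff by metis
  then have "norm (f x) \<le> max B 0" for x
    using assms(3)[of x] by (cases "x \<in> K") (auto simp: le_max_iff_disj)
  then show ?thesis using that by blast
qed

text \<open>Turns the Frechet derivative of a test function into the data required by
  \<open>transport_divergence\<close>. The coordinates of F are first directional derivatives and
  hence continuous; off the support \<phi> is locally zero, so F vanishes there and compactness
  gives the bounds.\<close>

lemma test_fun_gradient:
  fixes \<phi> :: "real^'n \<Rightarrow> real"
  assumes "test_fun \<Omega> \<phi>"
  obtains F B where "\<And>x. (\<phi> has_derivative (\<lambda>v. F x \<bullet> v)) (at x)" "continuous_on UNIV F"
    "\<And>x. norm (F x) \<le> B" "\<And>x. \<bar>\<phi> x\<bar> \<le> B"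
    "\<And>x v. frechet_derivative \<phi> (at x) v = F x \<bullet> v"
proof -
  define K where "K = closure {x. \<phi> x \<noteq> 0}"
  have sm: "dirderiv vs \<phi> differentiable_on UNIV" for vs
    using assms by (simp add: test_fun_def smooth_fun_def)
  have K: "compact K"
    using assms by (simp add: test_fun_def K_def)
  have D: "(\<phi> has_derivative frechet_derivative \<phi> (at x)) (at x)" for x
    using sm[of "[]"] by (simp add: differentiable_on_def frechet_derivative_works)
  define F where "F x = (\<Sum>b\<in>Basis. frechet_derivative \<phi> (at x) b *\<^sub>R b)" for x
  have FD: "frechet_derivative \<phi> (at x) v = F x \<bullet> v" for x v
  proof -
    interpret linear "frechet_derivative \<phi> (at x)"
      using D[of x] by (rule has_derivative_linear)
    have "frechet_derivative \<phi> (at x) v = frechet_derivative \<phi> (at x) (\<Sum>b\<in>Basis. (v \<bullet> b) *\<^sub>R b)"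
      by (simp add: euclidean_representation)
    also have "\<dots> = F x \<bullet> v"
      unfolding F_def sum scale inner_sum_left
      by (intro sum.cong refl) (simp add: inner_commute)
    finally show ?thesis .
  qed
  have der: "(\<phi> has_derivative (\<lambda>v. F x \<bullet> v)) (at x)" for x
    using D[of x] by (simp add: FD[abs_def])
  have cF: "continuous_on UNIV F"
    unfolding F_def using sm[of "[_]"]
    by (intro continuous_intros) (simp add: differentiable_imp_continuous_on)
  have cphi: "continuous_on UNIV \<phi>"
    using sm[of "[]"] by (simp add: differentiable_imp_continuous_on)
  have phi0: "\<phi> x = 0" if "x \<notin> K" for x
    using that closure_subset[of "{x. \<phi> x \<noteq> 0}"] by (auto simp: K_def)
  have F0: "F x = 0" if "x \<notin> K" for x
  proof -
    have "open (- K)" using compact_imp_closed[OF K] by (rule open_Compl)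
    then have "((\<lambda>_. 0) has_derivative (\<lambda>v. F x \<bullet> v)) (at x)"
      using that phi0 by (intro has_derivative_transform_within_open[OF der]) auto
    then have "(\<lambda>v. F x \<bullet> v) = (\<lambda>v. 0)"
      using has_derivative_unique has_derivative_const by blast
    then show ?thesis by (metis inner_eq_zero_iff)
  qed
  obtain B1 B2 where "\<And>x. norm (F x) \<le> B1" "\<And>x. norm (\<phi> x) \<le> B2"
    using continuous_compact_support_bounded[OF cF K F0] continuous_compact_support_bounded[OF cphi K phi0]
    by metis
  then have "norm (F x) \<le> max B1 B2" "\<bar>\<phi> x\<bar> \<le> max B1 B2" for x
    by (auto simp: le_max_iff_disj)
  then show ?thesis using that[OF der cF _ _ FD] by blast
qed

section \<open>A local right inverse of the divergence and the duality estimate\<close>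

text \<open>The field is \<open>transport\<close> for a Borel representative of g cut off to
  \<open>U\<close>. It vanishes off \<open>U\<close> \<subseteq> \<Omega>, so integrals over
  \<Omega> and over the whole space agree and the weak divergence can be tested on all of
  \<Omega>.\<close>

lemma divergence_inverse:
  fixes \<Omega> U :: "(real^'n) set"
  assumes "open \<Omega>" "open U" "convex U" "bounded U" "U \<noteq> {}" "U \<subseteq> \<Omega>"
    and g: "g \<in> L2 \<Omega>" and mean: "(\<integral>x. indicator U x * g x \<partial>lebesgue_on \<Omega>) = 0"
  obtains \<tau> where "\<tau> \<in> Hdiv \<Omega>" "(\<lambda>x. - (indicator U x * g x)) \<in> L2 \<Omega>"
    "weak_div \<Omega> \<tau> (\<lambda>x. - (indicator U x * g x))" "\<forall>x. x \<notin> U \<longrightarrow> \<tau> x = 0"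
    "(\<integral>x. (norm (\<tau> x))\<^sup>2 \<partial>lebesgue_on \<Omega>)
       \<le> 2 ^ CARD('n) * (diameter U)\<^sup>2 * (\<integral>x. indicator U x * (g x)\<^sup>2 \<partial>lebesgue_on \<Omega>)"
proof -
  have O [measurable]: "\<Omega> \<in> sets lebesgue" and U [measurable]: "U \<in> sets lebesgue"
    using assms by (auto intro: lebesgue_openin)
  define g0 where "g0 x = indicator U x * g x" for x
  have out: "g0 x = 0" if "x \<notin> \<Omega>" for x
  proof -
    have "x \<notin> U" using that assms by blast
    then show ?thesis by (simp add: g0_def)
  qed
  have g0m: "g0 \<in> borel_measurable (lebesgue_on \<Omega>)"
    unfolding g0_def using g borel_measurable_indicator_open[OF \<open>open U\<close>]
    by (intro borel_measurable_times) (auto simp: L2_def)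
  then have g0m' [measurable]: "g0 \<in> borel_measurable lebesgue"
    using integral_lebesgue_on_eq_lebesgue(3)[OF O, of g0] out by simp
  have sq: "(g0 x)\<^sup>2 = indicator U x * (g x)\<^sup>2" for x
    by (simp add: g0_def indicator_def)
  have g0sq: "integrable (lebesgue_on \<Omega>) (\<lambda>x. (g0 x)\<^sup>2)"
    unfolding sq using g \<open>open U\<close> by (intro integrable_indicator_open_mult) (simp_all add: L2_def)
  have g0sq': "integrable lebesgue (\<lambda>x. (g0 x)\<^sup>2)"
    using g0sq out integral_lebesgue_on_eq_lebesgue(2)[OF O, of "\<lambda>x. (g0 x)\<^sup>2"] by simp
  obtain g1 where g1 [measurable]: "g1 \<in> borel_measurable lborel" and "AE x in lborel. g0 x = g1 x"
    using completion_ex_borel_measurable_real[OF g0m'] by blast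
  \<comment> \<open>\<open>g1\<close> agrees with \<open>g0\<close> only almost everywhere; the
    cutoff makes the function vanish at every point off \<open>U\<close>, as the locale
    demands.\<close>
  define g2 where "g2 x = indicator U x * g1 x" for x
  have [measurable]: "U \<in> sets borel" using assms by simp
  have g2 [measurable]: "g2 \<in> borel_measurable borel"
    unfolding g2_def using g1 by measurable
  have [measurable]: "g2 \<in> borel_measurable lebesgue"
    by (rule measurable_completion) simp
  have ae: "AE x in lebesgue. g2 x = g0 x"
    using AE_completion[OF \<open>AE x in lborel. g0 x = g1 x\<close>]
    by eventually_elim (auto simp: g2_def g0_def indicator_def split: if_splits)
  have to_lebesgue: "integral\<^sup>L lborel h = integral\<^sup>L lebesgue h" if "h \<in> borel_measurable borel" for h :: "real^'n \<Rightarrow> real"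
    using that by (simp add: integral_completion)
  have g2sq: "integrable lborel (\<lambda>x. (g2 x)\<^sup>2)"
  proof -
    have "integrable lebesgue (\<lambda>x. (g2 x)\<^sup>2)"
      using ae by (intro integrable_cong_AE_imp[OF g0sq']) auto
    then show ?thesis by (subst (asm) integrable_completion) auto
  qed
  have "mean_zero_density U g2"
  proof
    have "(\<integral>x. g2 x \<partial>lborel) = (\<integral>x. g0 x \<partial>lebesgue)"
      using ae by (subst to_lebesgue) (auto intro!: integral_cong_AE)
    also have "\<dots> = (\<integral>x. g0 x \<partial>lebesgue_on \<Omega>)"
      using integral_lebesgue_on_eq_lebesgue(1)[OF O, of g0] out by simp
    finally show "(\<integral>x. g2 x \<partial>lborel) = 0" using mean by (simp add: g0_def)
  qed (use assms g2sq in \<open>auto simp: g2_def\<close>)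
  then interpret mean_zero_density U g2 .
  define G where "G = (\<integral>x. indicator U x * (g x)\<^sup>2 \<partial>lebesgue_on \<Omega>)"
  have G: "(\<integral>x. (g2 x)\<^sup>2 \<partial>lborel) = G"
  proof -
    have "(\<integral>x. (g2 x)\<^sup>2 \<partial>lborel) = (\<integral>x. (g0 x)\<^sup>2 \<partial>lebesgue)"
      using ae by (subst to_lebesgue) (auto intro!: integral_cong_AE)
    also have "\<dots> = (\<integral>x. (g0 x)\<^sup>2 \<partial>lebesgue_on \<Omega>)"
      using integral_lebesgue_on_eq_lebesgue(1)[OF O, of "\<lambda>x. (g0 x)\<^sup>2"] out by simp
    also have "\<dots> = G"
      by (simp add: G_def sq)
    finally show ?thesis .
  qed
  have G0: "G \<ge> 0" unfolding G[symmetric] by simp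
  have tO: "transport x = 0" if "x \<notin> \<Omega>" for x
    using that assms transport_outside by auto
  let ?c = "2 ^ CARD('n) * (diameter U)\<^sup>2 * G"
  have tb: "(\<integral>\<^sup>+z. ennreal ((norm (transport z))\<^sup>2) \<partial>lborel) \<le> ennreal ?c"
    using transport_bound unfolding G by simp
  have ti: "integrable lborel (\<lambda>z. (norm (transport z))\<^sup>2)"
    by (rule integrableI_bounded) (use tb in \<open>auto intro: le_less_trans\<close>)
  have "integrable lebesgue (\<lambda>z. (norm (transport z))\<^sup>2)"
    using ti by (subst integrable_completion) auto
  then have tL2: "transport \<in> L2vec \<Omega>"
    using integral_lebesgue_on_eq_lebesgue(2)[OF O, of "\<lambda>z. (norm (transport z))\<^sup>2"] tO
    by (auto simp: L2vec_def intro!: measurable_restrict_space1 measurable_completion)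
  have "ennreal (\<integral>z. (norm (transport z))\<^sup>2 \<partial>lborel) \<le> ennreal ?c"
    using tb nn_integral_eq_integral[OF ti] by simp
  then have "(\<integral>z. (norm (transport z))\<^sup>2 \<partial>lborel) \<le> ?c"
    using G0 by (subst (asm) ennreal_le_iff) auto
  also have "(\<integral>z. (norm (transport z))\<^sup>2 \<partial>lborel) = (\<integral>z. (norm (transport z))\<^sup>2 \<partial>lebesgue_on \<Omega>)"
    using integral_lebesgue_on_eq_lebesgue(1)[OF O, of "\<lambda>z. (norm (transport z))\<^sup>2"] tO
    by (subst to_lebesgue) auto
  finally have bound: "(\<integral>z. (norm (transport z))\<^sup>2 \<partial>lebesgue_on \<Omega>) \<le> ?c" .
  have wd: "weak_div \<Omega> transport (\<lambda>x. - g0 x)"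
    unfolding weak_div_def
  proof (intro allI impI)
    fix \<phi> assume "test_fun \<Omega> \<phi>"
    then obtain F B where F: "\<And>x. (\<phi> has_derivative (\<lambda>v. F x \<bullet> v)) (at x)" "continuous_on UNIV F"
      "\<And>x. norm (F x) \<le> B" "\<And>x. \<bar>\<phi> x\<bar> \<le> B"
      and FD: "\<And>x v. frechet_derivative \<phi> (at x) v = F x \<bullet> v"
      by (rule test_fun_gradient) (rule that)
    have [measurable]: "F \<in> borel_measurable borel"
      using F(2) by (rule borel_measurable_continuous_onI)
    have "continuous_on UNIV \<phi>"
      using F(1) by (meson continuous_at_imp_continuous_on has_derivative_continuous)
    then have [measurable]: "\<phi> \<in> borel_measurable borel"
      by (rule borel_measurable_continuous_onI)
    have [measurable]: "\<phi> \<in> borel_measurable lebesgue"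
      by (auto intro: measurable_completion)
    have "(\<integral>x. frechet_derivative \<phi> (at x) (transport x) \<partial>lebesgue_on \<Omega>) = (\<integral>x. F x \<bullet> transport x \<partial>lborel)"
      unfolding FD using tO integral_lebesgue_on_eq_lebesgue(1)[OF O, of "\<lambda>x. F x \<bullet> transport x"]
      by (subst to_lebesgue) auto
    also have "\<dots> = (\<integral>x. g2 x * \<phi> x \<partial>lborel)"
      by (rule transport_divergence[OF F])
    also have "\<dots> = (\<integral>x. g0 x * \<phi> x \<partial>lebesgue)"
      using ae by (subst to_lebesgue) (auto intro!: integral_cong_AE)
    also have "\<dots> = (\<integral>x. g0 x * \<phi> x \<partial>lebesgue_on \<Omega>)"
      using integral_lebesgue_on_eq_lebesgue(1)[OF O, of "\<lambda>x. g0 x * \<phi> x"] out by simp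
    finally show "(\<integral>x. frechet_derivative \<phi> (at x) (transport x) \<partial>lebesgue_on \<Omega>)
        = - (\<integral>x. - g0 x * \<phi> x \<partial>lebesgue_on \<Omega>)" by simp
  qed
  have gL2: "(\<lambda>x. - g0 x) \<in> L2 \<Omega>"
    using g0m g0sq by (simp add: L2_def)
  show ?thesis
  proof (rule that[of transport])
    show "transport \<in> Hdiv \<Omega>"
      using tL2 gL2 wd by (auto simp: Hdiv_def)
  qed (use gL2 wd transport_outside bound in \<open>auto simp: g0_def G_def\<close>)
qed

text \<open>Insert the field \<tau> of \<open>divergence_inverse\<close> into the duality relation:
  its divergence is - g on \<open>U\<close>, so the integral of g w over \<open>U\<close> is the
  inner product of e and \<tau> up to sign. Cauchy-Schwarz and the norm bound for \<tau>
  finish.\<close>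

lemma local_duality_estimate:
  fixes \<Omega> U :: "(real^'n) set"
  assumes U: "open \<Omega>" "open U" "convex U" "bounded U" "U \<noteq> {}" "U \<subseteq> \<Omega>"
    and g: "g \<in> L2 \<Omega>" and mean: "(\<integral>x. indicator U x * g x \<partial>lebesgue_on \<Omega>) = 0"
    and e: "e \<in> L2vec \<Omega>"
    and dual: "\<And>\<tau> d\<tau>. \<tau> \<in> Hdiv \<Omega> \<Longrightarrow> d\<tau> \<in> L2 \<Omega> \<Longrightarrow> weak_div \<Omega> \<tau> d\<tau> \<Longrightarrow>
      inner_L2vec \<Omega> e \<tau> = inner_L2 \<Omega> d\<tau> w"
  shows "\<bar>\<integral>x. indicator U x * (g x * w x) \<partial>lebesgue_on \<Omega>\<bar>
    \<le> sqrt (2 ^ CARD('n)) * (diameter U * sqrt (\<integral>x. indicator U x * (g x)\<^sup>2 \<partial>lebesgue_on \<Omega>)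
        * sqrt (\<integral>x. indicator U x * (norm (e x))\<^sup>2 \<partial>lebesgue_on \<Omega>))"
proof -
  let ?G = "\<integral>x. indicator U x * (g x)\<^sup>2 \<partial>lebesgue_on \<Omega>"
  obtain \<tau> where t: "\<tau> \<in> Hdiv \<Omega>" "(\<lambda>x. - (indicator U x * g x)) \<in> L2 \<Omega>"
    "weak_div \<Omega> \<tau> (\<lambda>x. - (indicator U x * g x))" "\<forall>x. x \<notin> U \<longrightarrow> \<tau> x = 0"
    "(\<integral>x. (norm (\<tau> x))\<^sup>2 \<partial>lebesgue_on \<Omega>) \<le> 2 ^ CARD('n) * (diameter U)\<^sup>2 * ?G"
    by (rule divergence_inverse[OF U g mean])
  have UL: "U \<in> sets lebesgue" using U by (auto intro: lebesgue_openin)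
  have "indicat_real U \<in> borel_measurable lebesgue" using UL by simp
  then have [measurable]: "indicat_real U \<in> borel_measurable (lebesgue_on \<Omega>)"
    by (rule measurable_restrict_space1)
  have em [measurable]: "e \<in> borel_measurable (lebesgue_on \<Omega>)"
    and ei: "integrable (lebesgue_on \<Omega>) (\<lambda>x. (norm (e x))\<^sup>2)" using e by (auto simp: L2vec_def)
  have n: "(norm (indicator U x *\<^sub>R e x))\<^sup>2 = indicator U x * (norm (e x))\<^sup>2" for x
    by (auto simp: indicator_def)
  have "integrable (lebesgue_on \<Omega>) (\<lambda>x. indicator U x * (norm (e x))\<^sup>2)"
    using U(2) ei by (rule integrable_indicator_open_mult)
  then have "\<bar>\<integral>x. (indicator U x *\<^sub>R e x) \<bullet> \<tau> x \<partial>lebesgue_on \<Omega>\<bar>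
    \<le> sqrt (\<integral>x. indicator U x * (norm (e x))\<^sup>2 \<partial>lebesgue_on \<Omega>) * sqrt (\<integral>x. (norm (\<tau> x))\<^sup>2 \<partial>lebesgue_on \<Omega>)"
    using t(1) Cauchy_Schwarz_integral[of "\<lambda>x. indicator U x *\<^sub>R e x" "lebesgue_on \<Omega>" \<tau>]
    unfolding n by (auto simp: Hdiv_def L2vec_def)
  also have "\<dots> \<le> sqrt (\<integral>x. indicator U x * (norm (e x))\<^sup>2 \<partial>lebesgue_on \<Omega>) * sqrt (2 ^ CARD('n) * (diameter U)\<^sup>2 * ?G)"
    using t(5) by (intro mult_left_mono) auto
  \<comment> \<open>The cutoff on e is harmless because \<tau> vanishes off \<open>U\<close>. It
    makes only the part of e on \<open>U\<close> appear in the bound, so that the local estimates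
    can be summed.\<close>
  also have "(\<lambda>x. (indicator U x *\<^sub>R e x) \<bullet> \<tau> x) = (\<lambda>x. e x \<bullet> \<tau> x)"
    using t(4) by (intro ext) (auto simp: indicator_def)
  also have "(\<integral>x. e x \<bullet> \<tau> x \<partial>lebesgue_on \<Omega>) = (\<integral>x. - (indicator U x * g x) * w x \<partial>lebesgue_on \<Omega>)"
    using dual[OF t(1-3)] by (simp add: inner_L2vec_def inner_L2_def)
  finally show ?thesis
    using diameter_ge_0[OF \<open>bounded U\<close>] by (simp add: real_sqrt_mult mult_ac)
qed

section \<open>Geometry of the triangulation and piecewise constants\<close>

text \<open>Only the coefficient of the zero multi-index is nonzero. The index set must be shown
  finite, since a sum over an infinite set has the value 0.\<close>

lemma const_poly_le: "(\<lambda>_ :: real^'n. k) \<in> poly_le q"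
proof -
  let ?S = "{\<alpha>::'n \<Rightarrow> nat. (\<Sum>i\<in>UNIV. \<alpha> i) \<le> q}"
  have "?S \<subseteq> PiE UNIV (\<lambda>_. {..q})"
  proof
    fix \<alpha> :: "'n \<Rightarrow> nat" assume "\<alpha> \<in> ?S"
    then have "\<alpha> i \<le> q" for i
      using member_le_sum[of i UNIV \<alpha>] by simp
    then show "\<alpha> \<in> PiE UNIV (\<lambda>_. {..q})" by (auto simp: PiE_def)
  qed
  then have fin: "finite ?S" by (rule finite_subset) (auto intro: finite_PiE)
  have "k = (\<Sum>\<alpha>\<in>?S. (if \<alpha> = (\<lambda>_. 0) then k else 0) * (\<Prod>i\<in>UNIV. (x $ i) ^ \<alpha> i))" for x :: "real^'n"
  proof -
    have "(\<Sum>\<alpha>\<in>?S. (if \<alpha> = (\<lambda>_. 0) then k else 0) * (\<Prod>i\<in>UNIV. (x $ i) ^ \<alpha> i))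
        = (\<Sum>\<alpha>\<in>?S. if \<alpha> = (\<lambda>_. 0) then k else 0)"
      by (intro sum.cong) auto
    also have "\<dots> = k" using fin by (simp add: sum.delta')
    finally show ?thesis by simp
  qed
  then show ?thesis
    unfolding poly_le_def mem_Collect_eq
    by (intro exI[of _ "\<lambda>\<alpha>. if \<alpha> = (\<lambda>_. 0) then k else 0"]) blast
qed

text \<open>Distinct vertex sets of size n + 1 share at most n points. By conformity the simplices
  meet in the hull of these, and the affine hull of at most n points has empty interior.\<close>

lemma simplex_interiors_disjoint:
  fixes V W :: "(real^'n) set"
  assumes "conforming_triangulation \<Omega> Th" "V \<in> Th" "W \<in> Th" "V \<noteq> W"
  shows "interior (convex hull V) \<inter> interior (convex hull W) = {}"
proof -
  have V: "finite V" "card V = CARD('n) + 1" "finite W" "card W = CARD('n) + 1"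
    and eq: "convex hull V \<inter> convex hull W = convex hull (V \<inter> W)"
    using assms by (auto simp: conforming_triangulation_def is_simplex_verts_def)
  have "V \<inter> W \<subset> V"
    using card_subset_eq[OF V(3), of V] V assms(4) by auto
  then have "card (V \<inter> W) < card V"
    by (rule psubset_card_mono[OF V(1)])
  then have "card (V \<inter> W) \<le> DIM(real^'n)"
    using V(2) by simp
  then have "interior (affine hull (V \<inter> W)) = {}"
    using V by (intro empty_interior_affine_hull) auto
  then have "interior (convex hull (V \<inter> W)) = {}"
    using interior_mono[OF convex_hull_subset_affine_hull] by blast
  then show ?thesis by (simp add: eq[symmetric])
qed

text \<open>The triangulation covers only the closure of \<Omega> by definition. Since a polyhedral
  \<Omega> is the interior of a closed set, an open subset of its closure lies in \<Omega>; a slit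
  domain would violate this.\<close>

lemma simplex_interior_subset:
  fixes \<Omega> :: "(real^'n) set"
  assumes "polyhedral \<Omega>" "conforming_triangulation \<Omega> Th" "V \<in> Th"
  shows "interior (convex hull V) \<subseteq> \<Omega>"
proof -
  obtain S where S: "finite S" "\<forall>V\<in>S. is_simplex_verts V" "\<Omega> = interior (\<Union>V\<in>S. convex hull V)"
    using assms(1) by (auto simp: polyhedral_def)
  have "closed (\<Union>V\<in>S. convex hull V)"
    using S by (intro closed_UN) (auto simp: is_simplex_verts_def finite_imp_compact_convex_hull compact_imp_closed)
  then have "closure \<Omega> \<subseteq> (\<Union>V\<in>S. convex hull V)"
    using S(3) interior_subset by (metis closure_minimal)
  moreover have "convex hull V \<subseteq> closure \<Omega>"
    using assms(2,3) by (auto simp: conforming_triangulation_def)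
  ultimately show ?thesis unfolding S(3) by (intro interior_mono) blast
qed

text \<open>Frontiers of convex sets are negligible, and off the finitely many frontiers each point
  of \<Omega> lies in exactly one interior.\<close>

lemma AE_simplex_interiors:
  fixes \<Omega> :: "(real^'n) set"
  assumes "open \<Omega>" "conforming_triangulation \<Omega> Th"
  shows "AE x in lebesgue_on \<Omega>. (\<Sum>V\<in>Th. indicator (interior (convex hull V)) x) = (1::real)"
proof -
  have fin: "finite Th" and cov: "closure \<Omega> = (\<Union>V\<in>Th. convex hull V)"
    using assms by (auto simp: conforming_triangulation_def)
  have "negligible (\<Union>V\<in>Th. frontier (convex hull V))"
    using fin by (intro negligible_Union) (auto intro: negligible_convex_frontier)
  then have "AE x in lebesgue. x \<notin> (\<Union>V\<in>Th. frontier (convex hull V))"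
    unfolding negligible_iff_null_sets by (rule AE_not_in)
  then have "AE x in lebesgue. x \<in> \<Omega> \<longrightarrow> (\<Sum>V\<in>Th. indicator (interior (convex hull V)) x) = (1::real)"
  proof eventually_elim
    case (elim x)
    show ?case
    proof
      assume "x \<in> \<Omega>"
      then obtain V where V: "V \<in> Th" "x \<in> convex hull V"
        using cov closure_subset by blast
      then have xV: "x \<in> interior (convex hull V)"
        using elim closure_subset[of "convex hull V"] by (auto simp: frontier_def)
      have "indicator (interior (convex hull W)) x = (if W = V then 1 else 0::real)" if "W \<in> Th" for W
        using simplex_interiors_disjoint[OF assms(2) that V(1)] xV
        by (cases "W = V") (auto simp: indicator_def)
      then have "(\<Sum>W\<in>Th. indicator (interior (convex hull W)) x) = (\<Sum>W\<in>Th. if W = V then 1 else 0::real)"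
        by (rule sum.cong[OF refl])
      then show "(\<Sum>W\<in>Th. indicator (interior (convex hull W)) x) = (1::real)"
        using fin V by simp
    qed
  qed
  then show ?thesis
    using assms by (subst AE_restrict_space_iff) (auto intro: lebesgue_openin)
qed

lemma integral_sum_simplex_interiors:
  fixes \<Omega> :: "(real^'n) set" and h :: "real^'n \<Rightarrow> real"
  assumes "open \<Omega>" "conforming_triangulation \<Omega> Th" and h: "integrable (lebesgue_on \<Omega>) h"
  shows "(\<integral>x. h x \<partial>lebesgue_on \<Omega>)
    = (\<Sum>V\<in>Th. \<integral>x. indicator (interior (convex hull V)) x * h x \<partial>lebesgue_on \<Omega>)"
proof -
  have [measurable]: "indicat_real (interior (convex hull V)) \<in> borel_measurable (lebesgue_on \<Omega>)" for V :: "(real^'n) set"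
    by (intro borel_measurable_indicator_open) simp
  have i: "integrable (lebesgue_on \<Omega>) (\<lambda>x. indicator (interior (convex hull V)) x * h x)" for V :: "(real^'n) set"
    using h by (intro integrable_indicator_open_mult) simp_all
  have "(\<integral>x. h x \<partial>lebesgue_on \<Omega>)
     = (\<integral>x. (\<Sum>V\<in>Th. indicator (interior (convex hull V)) x * h x) \<partial>lebesgue_on \<Omega>)"
  proof (rule integral_cong_AE)
    show "AE x in lebesgue_on \<Omega>. h x = (\<Sum>V\<in>Th. indicator (interior (convex hull V)) x * h x)"
      using AE_simplex_interiors[OF assms(1,2)]
      by eventually_elim (simp add: sum_distrib_right[symmetric])
  qed (use h i in auto)
  then show ?thesis using i by simp
qed

text \<open>\<open>osc\<close> integrates over closed simplices, whereas the estimates live on their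
  interiors inside \<Omega>; the two differ by a negligible frontier.\<close>

lemma integral_simplex_interior:
  fixes \<Omega> :: "(real^'n) set" and h :: "real^'n \<Rightarrow> real"
  assumes "open \<Omega>" "interior (convex hull V) \<subseteq> \<Omega>" "finite V" and h: "h \<in> borel_measurable (lebesgue_on \<Omega>)"
  shows "(\<integral>x. indicator (interior (convex hull V)) x * h x \<partial>lebesgue_on \<Omega>)
    = (\<integral>x. h x \<partial>lebesgue_on (convex hull V))"
proof -
  let ?K = "convex hull V"
  let ?U = "interior ?K"
  have O: "\<Omega> \<in> sets lebesgue" and U: "?U \<in> sets lebesgue" using assms by (auto intro: lebesgue_openin)
  have K: "?K \<in> sets lebesgue"
    using assms by (simp add: borel_closed finite_imp_compact_convex_hull compact_imp_closed)
  have "indicat_real ?U \<in> borel_measurable (lebesgue_on \<Omega>)"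
    by (intro borel_measurable_indicator_open) simp
  then have "(\<lambda>x. indicator ?U x * h x) \<in> borel_measurable (lebesgue_on \<Omega>)"
    using h by (rule borel_measurable_times)
  then have m: "(\<lambda>x. indicator ?U x * h x) \<in> borel_measurable lebesgue"
    using integral_lebesgue_on_eq_lebesgue(3)[OF O, of "\<lambda>x. indicator ?U x * h x"] assms(2)
    by (auto simp: indicator_def subset_iff)
  have "AE x in lebesgue. x \<notin> frontier ?K"
    using negligible_convex_frontier[OF convex_convex_hull]
    unfolding negligible_iff_null_sets by (rule AE_not_in)
  then have ae: "AE x in lebesgue. indicator ?U x * h x = indicator ?K x *\<^sub>R h x"
  proof eventually_elim
    case (elim x)
    then show ?case
      using closure_subset[of ?K] interior_subset[of ?K] by (auto simp: frontier_def indicator_def)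
  qed
  have "(\<integral>x. indicator ?U x * h x \<partial>lebesgue_on \<Omega>) = (\<integral>x. indicator ?U x * h x \<partial>lebesgue)"
    using assms(2) by (intro integral_lebesgue_on_eq_lebesgue(1)[OF O]) (auto simp: indicator_def)
  \<comment> \<open>Measurability of h is known only on \<Omega>, which may miss boundary points of
    the simplex. For the right integrand it follows from almost everywhere equality, Lebesgue
    measure being complete.\<close>
  also have "\<dots> = (\<integral>x. indicator ?K x *\<^sub>R h x \<partial>lebesgue)"
    by (rule integral_cong_AE[OF m borel_measurable_AE[OF m ae] ae])
  also have "\<dots> = (\<integral>x. h x \<partial>lebesgue_on ?K)"
    using K by (simp add: integral_restrict_space)
  finally show ?thesis .
qed

text \<open>Used as a test function in the projection, this indicator shows that f - fB has mean
  zero on each simplex.\<close>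

lemma indicator_simplex_interior_Vh:
  fixes \<Omega> :: "(real^'n) set"
  assumes "open \<Omega>" "bounded \<Omega>" "conforming_triangulation \<Omega> Th" "V \<in> Th"
  shows "indicator (interior (convex hull V)) \<in> Vh \<Omega> Th q"
proof -
  let ?U = "interior (convex hull V)"
  have "\<Omega> \<in> lmeasurable" using assms by (simp add: lmeasurable_open)
  then interpret finite_measure "lebesgue_on \<Omega>" by (rule finite_measure_lebesgue_on)
  have m: "indicat_real ?U \<in> borel_measurable (lebesgue_on \<Omega>)"
    by (intro borel_measurable_indicator_open) simp
  have "indicator ?U \<in> L2 \<Omega>"
  proof -
    have "integrable (lebesgue_on \<Omega>) (\<lambda>x. (indicat_real ?U x)\<^sup>2)"
    proof (rule integrable_const_bound[of _ 1])
      show "AE x in lebesgue_on \<Omega>. norm ((indicat_real ?U x)\<^sup>2) \<le> 1"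
        by (intro AE_I2) (simp add: indicator_def)
    qed (use m in \<open>rule borel_measurable_power\<close>)
    then show ?thesis using m by (simp add: L2_def)
  qed
  moreover have "\<exists>p \<in> poly_le q. AE x in lebesgue_on (interior (convex hull W)). indicator ?U x = p x" if "W \<in> Th" for W
  proof (rule bexI[of _ "\<lambda>_. if W = V then 1 else 0"])
    show "AE x in lebesgue_on (interior (convex hull W)). indicator ?U x = (if W = V then 1 else 0::real)"
      using simplex_interiors_disjoint[OF assms(3) that assms(4)]
      by (cases "W = V") (auto intro!: AE_I2 simp: indicator_def)
  qed (rule const_poly_le)
  ultimately show ?thesis by (simp add: Vh_def)
qed

section \<open>The error equation and the global estimate\<close>

text \<open>Subtracting the first equations gives the duality relation. For the energy identity it
  is tested with \<sigma> and \<sigma>' separately, each with the divergence supplied by its own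
  problem, and the second equations are tested with w.\<close>

lemma mixed_solution_diff:
  assumes 1: "mixed_solution \<Omega> f \<sigma> u" and 2: "mixed_solution \<Omega> f' \<sigma>' u'"
    and f: "f \<in> L2 \<Omega>" "f' \<in> L2 \<Omega>"
  defines "e \<equiv> \<lambda>x. \<sigma> x - \<sigma>' x" and "w \<equiv> \<lambda>x. u x - u' x" and "g \<equiv> \<lambda>x. f x - f' x"
  shows "\<And>\<tau> d\<tau>. \<tau> \<in> Hdiv \<Omega> \<Longrightarrow> d\<tau> \<in> L2 \<Omega> \<Longrightarrow> weak_div \<Omega> \<tau> d\<tau> \<Longrightarrow>
      inner_L2vec \<Omega> e \<tau> = inner_L2 \<Omega> d\<tau> w"
    and "inner_L2vec \<Omega> e e = inner_L2 \<Omega> g w"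
proof -
  have s: "\<sigma> \<in> Hdiv \<Omega>" "\<sigma>' \<in> Hdiv \<Omega>" "u \<in> L2 \<Omega>" "u' \<in> L2 \<Omega>"
    using 1 2 by (auto simp: mixed_solution_def)
  then have v: "\<sigma> \<in> L2vec \<Omega>" "\<sigma>' \<in> L2vec \<Omega>" by (auto simp: Hdiv_def)
  have dual: "inner_L2vec \<Omega> \<sigma> \<tau> = inner_L2 \<Omega> d\<tau> u" "inner_L2vec \<Omega> \<sigma>' \<tau> = inner_L2 \<Omega> d\<tau> u'"
    if "\<tau> \<in> Hdiv \<Omega>" "d\<tau> \<in> L2 \<Omega>" "weak_div \<Omega> \<tau> d\<tau>" for \<tau> d\<tau>
    using 1 2 that by (auto simp: mixed_solution_def)
  have el: "inner_L2vec \<Omega> e \<tau> = inner_L2vec \<Omega> \<sigma> \<tau> - inner_L2vec \<Omega> \<sigma>' \<tau>" if "\<tau> \<in> L2vec \<Omega>" for \<tau>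
    using L2vec_inner_integrable[OF v(1) that] L2vec_inner_integrable[OF v(2) that]
    by (simp add: inner_L2vec_def e_def inner_diff_left)
  have wr: "inner_L2 \<Omega> h w = inner_L2 \<Omega> h u - inner_L2 \<Omega> h u'" if "h \<in> L2 \<Omega>" for h
    using L2_mult_integrable[OF that s(3)] L2_mult_integrable[OF that s(4)]
    by (simp add: inner_L2_def w_def right_diff_distrib)
  show D: "inner_L2vec \<Omega> e \<tau> = inner_L2 \<Omega> d\<tau> w"
    if "\<tau> \<in> Hdiv \<Omega>" "d\<tau> \<in> L2 \<Omega>" "weak_div \<Omega> \<tau> d\<tau>" for \<tau> d\<tau>
    using dual[OF that] el[of \<tau>] wr[OF that(2)] that(1) by (simp add: Hdiv_def)
  have w: "w \<in> L2 \<Omega>" unfolding w_def using s by (intro L2_diff)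
  have e: "e \<in> L2vec \<Omega>" unfolding e_def using v by (intro L2vec_diff)
  obtain d1 where d1: "d1 \<in> L2 \<Omega>" "weak_div \<Omega> \<sigma> d1" "\<And>v. v \<in> L2 \<Omega> \<Longrightarrow> inner_L2 \<Omega> d1 v = inner_L2 \<Omega> f v"
    using 1 by (auto simp: mixed_solution_def)
  obtain d2 where d2: "d2 \<in> L2 \<Omega>" "weak_div \<Omega> \<sigma>' d2" "\<And>v. v \<in> L2 \<Omega> \<Longrightarrow> inner_L2 \<Omega> d2 v = inner_L2 \<Omega> f' v"
    using 2 by (auto simp: mixed_solution_def)
  have "inner_L2vec \<Omega> e e = inner_L2vec \<Omega> e \<sigma> - inner_L2vec \<Omega> e \<sigma>'"
    using L2vec_inner_integrable[OF e v(1)] L2vec_inner_integrable[OF e v(2)]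
    by (simp add: inner_L2vec_def e_def inner_diff_right)
  also have "\<dots> = inner_L2 \<Omega> f w - inner_L2 \<Omega> f' w"
    using D[OF s(1) d1(1,2)] D[OF s(2) d2(1,2)] d1(3)[OF w] d2(3)[OF w] by simp
  also have "\<dots> = inner_L2 \<Omega> g w"
    using L2_mult_integrable[OF f(1) w] L2_mult_integrable[OF f(2) w]
    by (simp add: inner_L2_def g_def left_diff_distrib)
  finally show "inner_L2vec \<Omega> e e = inner_L2 \<Omega> g w" .
qed

theorem theorem4p1:
  fixes \<Omega> :: "(real^'n) set" and q :: nat and \<kappa> :: real
  assumes "CARD('n) \<ge> 2"
    and "lipschitz_polyhedral_domain \<Omega>"
  shows "\<exists>C. \<forall>Th f fB \<sigma> u \<sigma>' u'.
            conforming_triangulation \<Omega> Th \<and> shape_regular \<kappa> Th \<and>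
            f \<in> L2 \<Omega> \<and> L2_proj \<Omega> (Vh \<Omega> Th q) f fB \<and>
            mixed_solution \<Omega> f \<sigma> u \<and> mixed_solution \<Omega> fB \<sigma>' u'
            \<longrightarrow> norm_L2vec \<Omega> (\<lambda>x. \<sigma> x - \<sigma>' x) \<le> C * osc Th f fB"
\<comment> \<open>The constant is that of \<open>local_duality_estimate\<close>; summation leaves it
  unchanged because the simplices overlap only in null sets.\<close>
proof (intro exI[of _ "sqrt (2 ^ CARD('n))"] allI impI, elim conjE)
  fix Th f fB \<sigma> u \<sigma>' u'
  assume T: "conforming_triangulation \<Omega> Th" and f: "f \<in> L2 \<Omega>"
    and P: "L2_proj \<Omega> (Vh \<Omega> Th q) f fB"
    and sol: "mixed_solution \<Omega> f \<sigma> u" "mixed_solution \<Omega> fB \<sigma>' u'"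
  let ?c = "sqrt (2 ^ CARD('n))"
  have O: "open \<Omega>" "bounded \<Omega>" "polyhedral \<Omega>"
    using assms by (auto simp: lipschitz_polyhedral_domain_def)
  have fB: "fB \<in> L2 \<Omega>" using P by (simp add: L2_proj_def Vh_def)
  define e where "e = (\<lambda>x. \<sigma> x - \<sigma>' x)"
  define w where "w = (\<lambda>x. u x - u' x)"
  define g where "g = (\<lambda>x. f x - fB x)"
  have g: "g \<in> L2 \<Omega>" unfolding g_def using f fB by (rule L2_diff)
  have w: "w \<in> L2 \<Omega>" unfolding w_def using sol by (intro L2_diff) (auto simp: mixed_solution_def)
  have e: "e \<in> L2vec \<Omega>" unfolding e_def using sol by (intro L2vec_diff) (auto simp: mixed_solution_def Hdiv_def)
  note diff = mixed_solution_diff[OF sol f fB, folded e_def w_def g_def]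
  define U where "U V = interior (convex hull V)" for V :: "(real^'n) set"
  define a where "a V = diameter (convex hull V) * sqrt (\<integral>x. indicator (U V) x * (g x)\<^sup>2 \<partial>lebesgue_on \<Omega>)" for V
  define b where "b V = sqrt (\<integral>x. indicator (U V) x * (norm (e x))\<^sup>2 \<partial>lebesgue_on \<Omega>)" for V
  define E where "E = (\<integral>x. (norm (e x))\<^sup>2 \<partial>lebesgue_on \<Omega>)"
  have E0: "E \<ge> 0" by (simp add: E_def)
  have V: "finite V" "card V = Suc DIM(real^'n)" "\<not> affine_dependent V" "U V \<subseteq> \<Omega>" if "V \<in> Th" for V
    using T that simplex_interior_subset[OF O(3) T that]
    by (auto simp: conforming_triangulation_def is_simplex_verts_def U_def)
  have local: "\<bar>\<integral>x. indicator (U V) x * (g x * w x) \<partial>lebesgue_on \<Omega>\<bar> \<le> ?c * (a V * b V)" if "V \<in> Th" for V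
  proof -
    have K: "bounded (convex hull V)"
      using V[OF that] by (simp add: finite_imp_compact_convex_hull compact_imp_bounded)
    have bU: "bounded (U V)" "U V \<subseteq> convex hull V" unfolding U_def using K interior_subset bounded_subset by auto
    have "inner_L2 \<Omega> g (indicator (U V)) = 0"
      using P indicator_simplex_interior_Vh[OF O(1,2) T that, of q]
      by (simp add: L2_proj_def g_def U_def)
    then have mean: "(\<integral>x. indicator (U V) x * g x \<partial>lebesgue_on \<Omega>) = 0"
      by (simp add: inner_L2_def mult.commute)
    have ne: "U V \<noteq> {}"
      using interior_convex_hull_eq_empty[OF V(2)[OF that]] V(3)[OF that] by (simp add: U_def)
    have "\<bar>\<integral>x. indicator (U V) x * (g x * w x) \<partial>lebesgue_on \<Omega>\<bar>
      \<le> ?c * (diameter (U V) * sqrt (\<integral>x. indicator (U V) x * (g x)\<^sup>2 \<partial>lebesgue_on \<Omega>) * b V)"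
      unfolding b_def
      by (rule local_duality_estimate[OF O(1) _ _ bU(1) ne V(4)[OF that] g mean e diff(1)])
         (auto simp: U_def convex_interior)
    also have "\<dots> \<le> ?c * (a V * b V)"
      unfolding a_def using diameter_subset[OF bU(2) K]
      by (intro mult_left_mono mult_right_mono) (auto simp: b_def)
    finally show ?thesis .
  qed
  have "E = inner_L2vec \<Omega> e e"
    by (simp add: E_def inner_L2vec_def power2_norm_eq_inner)
  also have "\<dots> = (\<integral>x. g x * w x \<partial>lebesgue_on \<Omega>)"
    by (simp add: diff(2) inner_L2_def)
  also have "\<dots> = (\<Sum>V\<in>Th. \<integral>x. indicator (U V) x * (g x * w x) \<partial>lebesgue_on \<Omega>)"
    unfolding U_def by (rule integral_sum_simplex_interiors[OF O(1) T L2_mult_integrable[OF g w]])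
  also have "\<dots> \<le> (\<Sum>V\<in>Th. ?c * (a V * b V))"
    using local by (intro sum_mono) (auto dest: abs_le_D1)
  \<comment> \<open>Absolute values are inserted to match the discrete Cauchy-Schwarz inequality
    \<open>L2_set_mult_ineq\<close>, which separates the oscillation from the error.\<close>
  also have "\<dots> \<le> ?c * (\<Sum>V\<in>Th. \<bar>a V\<bar> * \<bar>b V\<bar>)"
    unfolding sum_distrib_left[symmetric]
    by (intro mult_left_mono sum_mono) (auto simp: abs_mult[symmetric])
  also have "\<dots> \<le> ?c * (L2_set a Th * L2_set b Th)"
    by (intro mult_left_mono L2_set_mult_ineq) simp
  also have "L2_set b Th = sqrt E"
  proof -
    have "(\<Sum>V\<in>Th. (b V)\<^sup>2) = (\<Sum>V\<in>Th. \<integral>x. indicator (U V) x * (norm (e x))\<^sup>2 \<partial>lebesgue_on \<Omega>)"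
      unfolding b_def by (intro sum.cong refl real_sqrt_pow2) simp
    also have "\<dots> = E"
      unfolding U_def E_def using e
      by (intro integral_sum_simplex_interiors[OF O(1) T, symmetric]) (simp add: L2vec_def)
    finally show ?thesis by (simp add: L2_set_def)
  qed
  also have "L2_set a Th = osc Th f fB"
    unfolding L2_set_def osc_def
  proof (intro arg_cong[where f=sqrt] sum.cong refl)
    fix V assume "V \<in> Th"
    have "(\<integral>x. indicator (U V) x * (g x)\<^sup>2 \<partial>lebesgue_on \<Omega>) = (\<integral>x. (f x - fB x)\<^sup>2 \<partial>lebesgue_on (convex hull V))"
      unfolding U_def using V[OF \<open>V \<in> Th\<close>] g O
      by (subst integral_simplex_interior) (auto simp: U_def L2_def g_def)
    then show "(a V)\<^sup>2 = (diameter (convex hull V))\<^sup>2 * (\<integral>x. (f x - fB x)\<^sup>2 \<partial>lebesgue_on (convex hull V))"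
      by (simp add: a_def power_mult_distrib)
  qed
  \<comment> \<open>One factor \<open>sqrt E\<close> is to be cancelled; for E = 0 the claim is
    instead the nonnegativity of the right-hand side.\<close>
  finally have "sqrt E * sqrt E \<le> (?c * osc Th f fB) * sqrt E"
    using E0 by (simp add: mult_ac)
  moreover have "0 \<le> ?c * osc Th f fB"
    unfolding osc_def by (intro mult_nonneg_nonneg real_sqrt_ge_zero sum_nonneg) auto
  ultimately have "sqrt E \<le> ?c * osc Th f fB"
    using E0 by (cases "E = 0") (auto intro: mult_right_le_imp_le[of _ "sqrt E"] simp del: real_sqrt_mult_self)
  then show "norm_L2vec \<Omega> (\<lambda>x. \<sigma> x - \<sigma>' x) \<le> ?c * osc Th f fB"
    by (simp add: norm_L2vec_def E_def e_def)
qed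

end
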